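(* (Complete Pythagorean theorem) Let $\mathcal A$ be a C*-subalgebra of $\mathrm{Mat}(n,\mathbb C)$, let $\Theta\subset\mathcal A_{\mathrm{sa}}$ be a non-empty real affine subspace, and let $\mathcal E=R_{\mathcal A}(\Theta)$ be the associated exponential family. If $\rho\in\mathcal S_{\mathcal A}$ and if $\sigma$ lies in the extension $\mathrm{ext}(\mathcal E)$, then $$S(\rho,\pi_{\mathcal E}(\rho))+S(\pi_{\mathcal E}(\rho),\sigma)=S(\rho,\sigma).$$
   Context: A C*-subalgebra $\mathcal A$ of $\mathrm{Mat}(n,\mathbb C)$ is a (non-zero) complex subalgebra closed under conjugate transpose; its identity $\mathbb 1$ need not be $\mathbb 1_n$. $\mathcal A_{\mathrm{sa}}$ is the real Euclidean space of self-adjoint elements with $\langle a,b\rangle=\mathrm{tr}(ab)$. State space: $\mathcal S=\mathcal S_{\mathcal A}=\{\rho\in\mathcal A\mid\rho\succeq0,\ \mathrm{tr}(\rho)=1\}$. Relative entropy: $S(\rho,\sigma)=\mathrm{tr}\,\rho(\log\rho-\log\sigma)$ if $\mathrm{Im}(\rho)\subset\mathrm{Im}(\sigma)$ (logarithms taken on the respective images and extended by $0$ on the kernels), otherwise $+\infty$. $\exp_{\mathcal A}(a)=\mathbb 1+\sum_{i\ge1}a^i/i!$ and $R_{\mathcal A}(\theta)=\exp_{\mathcal A}(\theta)/\mathrm{tr}(\exp_{\mathcal A}(\theta))$ for $\theta\in\mathcal A_{\mathrm{sa}}$. $U:=\Theta-\Theta$ is the translation vector space of $\Theta$, $\pi_U:\mathcal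 A_{\mathrm{sa}}\to U$ the orthogonal projection, $U^\perp$ the orthogonal complement in $\mathcal A_{\mathrm{sa}}$, and $\mathbb M(U):=\pi_U(\mathcal S_{\mathcal A})$ the mean value set. A face of a convex set $K$ is a convex subset $F\subset K$ (possibly empty) such that whenever $x,y\in K$ and the open segment $]x,y[$ meets $F$, then $[x,y]\subset F$. For a projection $p=p^2=p^*\in\mathcal A$, $p\mathcal Ap$ is the compressed algebra with identity $p$ and $\mathcal S_{p\mathcal Ap}$ its state space. The projection lattice $\mathcal P^U$ is the set of projections $p\in\mathcal A$ such that $\mathcal S_{p\mathcal Ap}=\mathcal S_{\mathcal A}\cap(F+U^\perp)$ for some face $F$ of $\mathbb M(U)$. For non-zero $p$ put $\mathcal E_p:=R_{p\mathcal Ap}(p\Theta p)$, where $p\Theta p=\{p\theta p\mid\theta\in\Theta\}$. The extension of $\mathcal E$ is $\mathrm{ext}(\mathcal E):=\bigcup_{p\in\mathcal P^U\setminus\{0\}}\mathcal E_p$. The restriction $\pi_U|_{\mathrm{ext}(\mathcal E)}:\mathrm{ext}(\mathcal E)\to\mathbb M(U)$ is a bijection, and $\pi_{\mathcal E}:\mathcal S_{\mathcal A}\to\mathrm{ext}(\mathcal E)$ is defined by letting $\pi_{\mathcal E}(\rho)$ be the unique element of $\mathrm{ext}(\mathcal E)$ with $\pi_U(\pi_{\mathcal E}(\rho))=\pi_U(\rho)$. *)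

theory Defs
  imports "HOL-Analysis.Analysis"
begin

text \<open>
  Matrices are elements of \<open>complex^'n^'n\<close>; since types are non-empty, \<open>n \<ge> 1\<close>.  The matrix product
  is \<open>**\<close>: the ring operations \<open>*\<close>, \<open>1\<close>, \<open>^\<close> on this type act entrywise and are not used.
\<close>

definition cscale :: "complex \<Rightarrow> complex^'n^'m \<Rightarrow> complex^'n^'m"
  where "cscale c a = (\<chi> i j. c * a $ i $ j)"

definition ctranspose :: "complex^'n^'m \<Rightarrow> complex^'m^'n"
  where "ctranspose a = (\<chi> i j. cnj (a $ j $ i))"

primrec mpow :: "complex^'n^'n \<Rightarrow> nat \<Rightarrow> complex^'n^'n"
  where
    "mpow a 0 = mat 1"
  | "mpow a (Suc k) = a ** mpow a k"

definition cstar_subalgebra :: "(complex^'n^'n) set \<Rightarrow> bool"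
  where "cstar_subalgebra A \<longleftrightarrow>
    0 \<in> A \<and> A \<noteq> {0} \<and>
    (\<forall>a\<in>A. \<forall>b\<in>A. a + b \<in> A) \<and>
    (\<forall>c. \<forall>a\<in>A. cscale c a \<in> A) \<and>
    (\<forall>a\<in>A. \<forall>b\<in>A. a ** b \<in> A) \<and>
    (\<forall>a\<in>A. ctranspose a \<in> A)"

text \<open>The identity of the algebra \<open>A\<close>, in general different from \<open>mat 1\<close>.\<close>

definition alg_one :: "(complex^'n^'n) set \<Rightarrow> complex^'n^'n"
  where "alg_one A = (THE e. e \<in> A \<and> (\<forall>a\<in>A. e ** a = a \<and> a ** e = a))"

definition self_adjoint :: "(complex^'n^'n) set \<Rightarrow> (complex^'n^'n) set"
  where "self_adjoint A = {a\<in>A. ctranspose a = a}"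

text \<open>On self-adjoint matrices the inner product \<open>\<bullet>\<close> of the library is \<open>tr(ab)\<close>.\<close>

lemma inner_eq_trace:
  fixes a b :: "complex^'n^'n"
  assumes a: "ctranspose a = a" and b: "ctranspose b = b"
  shows "complex_of_real (a \<bullet> b) = trace (a ** b)"
proof -
  have sa: "cnj (c $ j $ i) = c $ i $ j" if "ctranspose c = c" for c :: "complex^'n^'n" and i j
  proof -
    have "ctranspose c $ i $ j = cnj (c $ j $ i)"
      by (simp add: ctranspose_def)
    then show ?thesis
      using that by simp
  qed
  have tr: "trace (a ** b) = (\<Sum>i\<in>UNIV. \<Sum>j\<in>UNIV. a $ i $ j * b $ j $ i)"
    by (simp add: trace_def matrix_matrix_mult_def)
  have "cnj (trace (a ** b)) = (\<Sum>i\<in>UNIV. \<Sum>j\<in>UNIV. a $ j $ i * b $ i $ j)"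
    by (simp add: tr sa[OF a] sa[OF b])
  also have "\<dots> = trace (a ** b)"
    unfolding tr by (rule sum.swap)
  finally have real: "trace (a ** b) = complex_of_real (Re (trace (a ** b)))"
    by (metis Reals_cnj_iff of_real_Re)
  have "a \<bullet> b = (\<Sum>i\<in>UNIV. \<Sum>j\<in>UNIV. Re (a $ i $ j * cnj (b $ i $ j)))"
    by (simp add: inner_vec_def inner_complex_def)
  also have "\<dots> = Re (trace (a ** b))"
    by (simp only: tr sa[OF b] Re_sum)
  finally show ?thesis
    using real by simp
qed

text \<open>\<open>x \<bullet> (a *v x)\<close> is the real part of \<open>x\<^sup>* a x\<close>, which is real for self-adjoint \<open>a\<close>.\<close>

definition psd :: "complex^'n^'n \<Rightarrow> bool"
  where "psd a \<longleftrightarrow> ctranspose a = a \<and> (\<forall>x. 0 \<le> x \<bullet> (a *v x))"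

definition states :: "(complex^'n^'n) set \<Rightarrow> (complex^'n^'n) set"
  where "states A = {\<rho>\<in>A. psd \<rho> \<and> trace \<rho> = 1}"

definition projection :: "complex^'n^'n \<Rightarrow> bool"
  where "projection p \<longleftrightarrow> p ** p = p \<and> ctranspose p = p"

definition im :: "complex^'n^'n \<Rightarrow> (complex^'n) set"
  where "im a = range ((*v) a)"

definition eigenspace :: "complex^'n^'n \<Rightarrow> real \<Rightarrow> (complex^'n) set"
  where "eigenspace a l = {x. a *v x = complex_of_real l *s x}"

definition spectral_proj :: "complex^'n^'n \<Rightarrow> real \<Rightarrow> complex^'n^'n"
  where "spectral_proj a l = (THE p. projection p \<and> im p = eigenspace a l)"

text \<open>
  For positive semidefinite \<open>a\<close>, the logarithm of \<open>a\<close> on its image (the sum of the eigenspaces for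
  the eigenvalues \<open>l > 0\<close>), extended by \<open>0\<close> on the kernel.
\<close>

definition mlog :: "complex^'n^'n \<Rightarrow> complex^'n^'n"
  where "mlog a = (\<Sum>l\<in>{l. 0 < l \<and> eigenspace a l \<noteq> {0}}. ln l *\<^sub>R spectral_proj a l)"

definition rel_entropy :: "complex^'n^'n \<Rightarrow> complex^'n^'n \<Rightarrow> ereal"
  where "rel_entropy \<rho> \<sigma> =
    (if im \<rho> \<subseteq> im \<sigma> then ereal (Re (trace (\<rho> ** (mlog \<rho> - mlog \<sigma>)))) else \<infinity>)"

definition alg_exp :: "(complex^'n^'n) set \<Rightarrow> complex^'n^'n \<Rightarrow> complex^'n^'n"
  where "alg_exp A a = alg_one A + (\<Sum>i. (1 / fact (Suc i)) *\<^sub>R mpow a (Suc i))"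

definition gibbs :: "(complex^'n^'n) set \<Rightarrow> complex^'n^'n \<Rightarrow> complex^'n^'n"
  where "gibbs A \<theta> = cscale (1 / trace (alg_exp A \<theta>)) (alg_exp A \<theta>)"

definition exp_family :: "(complex^'n^'n) set \<Rightarrow> (complex^'n^'n) set \<Rightarrow> (complex^'n^'n) set"
  where "exp_family A \<Theta> = gibbs A ` \<Theta>"

definition translation_space :: "(complex^'n^'n) set \<Rightarrow> (complex^'n^'n) set"
  where "translation_space \<Theta> = {s - t | s t. s \<in> \<Theta> \<and> t \<in> \<Theta>}"

definition orth_proj :: "(complex^'n^'n) set \<Rightarrow> complex^'n^'n \<Rightarrow> complex^'n^'n"
  where "orth_proj U a = (THE u. u \<in> U \<and> (\<forall>w\<in>U. orthogonal (a - u) w))"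

definition perp :: "(complex^'n^'n) set \<Rightarrow> (complex^'n^'n) set \<Rightarrow> (complex^'n^'n) set"
  where "perp A U = {a\<in>self_adjoint A. \<forall>w\<in>U. orthogonal a w}"

definition mean_value_set :: "(complex^'n^'n) set \<Rightarrow> (complex^'n^'n) set \<Rightarrow> (complex^'n^'n) set"
  where "mean_value_set A U = orth_proj U ` states A"

definition compress :: "complex^'n^'n \<Rightarrow> (complex^'n^'n) set \<Rightarrow> (complex^'n^'n) set"
  where "compress p A = (\<lambda>a. p ** a ** p) ` A"

lemma alg_one_compress:
  assumes p: "p ** p = p" and A: "p \<in> A"
  shows "alg_one (compress p A) = p"
  unfolding alg_one_def
proof (rule the_equality)
  have "p = p ** p ** p"
    by (simp add: p)
  then have pA: "p \<in> compress p A"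
    unfolding compress_def using A by blast
  have l: "p ** b = b" if "b \<in> compress p A" for b
    using that by (auto simp: compress_def matrix_mul_assoc p)
  have r: "b ** p = b" if "b \<in> compress p A" for b
    using that by (auto simp: compress_def p simp flip: matrix_mul_assoc)
  show "p \<in> compress p A \<and> (\<forall>a\<in>compress p A. p ** a = a \<and> a ** p = a)"
    using pA l r by blast
  show "e = p" if "e \<in> compress p A \<and> (\<forall>a\<in>compress p A. e ** a = a \<and> a ** e = a)" for e
    using that pA r[of e] by metis
qed

definition proj_lattice :: "(complex^'n^'n) set \<Rightarrow> (complex^'n^'n) set \<Rightarrow> (complex^'n^'n) set"
  where "proj_lattice A U = {p\<in>A. projection p \<and>
    (\<exists>F. F face_of mean_value_set A U \<and>
      states (compress p A) = states A \<inter> {f + v | f v. f \<in> F \<and> v \<in> perp A U})}"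

definition ext_family :: "(complex^'n^'n) set \<Rightarrow> (complex^'n^'n) set \<Rightarrow> (complex^'n^'n) set"
  where "ext_family A \<Theta> =
    (\<Union>p \<in> proj_lattice A (translation_space \<Theta>) - {0}. exp_family (compress p A) (compress p \<Theta>))"

definition proj_family ::
    "(complex^'n^'n) set \<Rightarrow> (complex^'n^'n) set \<Rightarrow> complex^'n^'n \<Rightarrow> complex^'n^'n"
  where "proj_family A \<Theta> \<rho> =
    (THE \<tau>. \<tau> \<in> ext_family A \<Theta> \<and>
      orth_proj (translation_space \<Theta>) \<tau> = orth_proj (translation_space \<Theta>) \<rho>)"

end

theory Submission
  imports Defs
begin

text \<open>
  Let \<open>\<tau>\<close> be an element of the extension with the mean value of \<open>\<rho>\<close> and support \<open>q\<close>, and let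
  \<open>p\<close> be the support of \<open>\<sigma>\<close>.  The logarithms of \<open>\<tau>\<close> and \<open>\<sigma>\<close> are \<open>q t q - d q\<close> and
  \<open>p s p - c p\<close> with \<open>s - t \<in> U\<close>.  Membership of a state in \<open>p A p\<close> depends only on its mean value,
  so all supports are nested as needed, and the identity reduces to \<open>(\<rho> - \<tau>) \<bullet> (s - t) = 0\<close>.

  Such a \<open>\<tau>\<close> is unique by strict monotonicity of the exponential.  For existence, take the
  smallest face of the mean value set containing the mean value \<open>m\<close> of \<open>\<rho>\<close>, that is, the points
  from which the segment to \<open>m\<close> can be prolonged beyond \<open>m\<close>, and let \<open>q\<close> be the support
  of a state of maximal rank over it.  Then \<open>tr (exp (q (\<theta> + u) q - \<langle>\<rho>, \<theta> + u\<rangle> q))\<close> attains its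
  minimum over \<open>u \<in> U\<close>, and stationarity is the equality of mean values.

  Matrices act on \<open>complex^'n\<close> as a real Euclidean space of dimension \<open>2 n\<close>, on which
  Hermitian means symmetric.
\<close>

section \<open>Spectral theorem in Euclidean spaces\<close>

text \<open>If the mean value \<open>m\<close> lies on the relative boundary of the mean value set,
  the minimum over all of \<open>A\<close> is not attained; passing to the smallest face repairs
  this. Centre each \<open>w\<close> in \<open>U\<close> to
  \<open>c = q w q - (\<rho> \<bullet> w) q\<close>, so that \<open>\<rho> \<bullet> c = 0\<close>.
  If the form of \<open>c\<close> is nowhere positive, then \<open>- c\<close> is positive
  semidefinite and \<open>\<rho>\<close> maximises the pairing with \<open>w\<close> over the states
  of \<open>q A q\<close>. Prolonging segments beyond \<open>m\<close> then forces every such state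
  to be orthogonal to \<open>c\<close>; unless \<open>c = 0\<close>, the normalised
  \<open>- c\<close> is one of them, which is absurd. So the trace is unbounded along each non-zero
  centred direction. Directions with \<open>c = 0\<close> do not change it, and therefore the
  minimum is taken over the image of \<open>U\<close> under centring. Centring also removes the
  normalisation: the trace to be minimised is the partition function times
  \<open>exp (- \<rho> \<bullet> (\<theta> + u))\<close>, and its stationarity is linear in the
  unnormalised exponential.\<close>

definition orthonormal_basis :: "'a::euclidean_space set \<Rightarrow> 'a set \<Rightarrow> bool"
  where "orthonormal_basis B S \<longleftrightarrow>
    finite B \<and> pairwise orthogonal B \<and> (\<forall>e\<in>B. norm e = 1) \<and> span B = S"

lemma orthonormal_basis_Basis: "orthonormal_basis Basis UNIV"
  by (auto simp: orthonormal_basis_def pairwise_def orthogonal_def inner_Basis)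

lemma orthonormal_basis_inner:
  assumes "orthonormal_basis B S" "d \<in> B" "e \<in> B"
  shows "d \<bullet> e = (if d = e then 1 else 0)"
  using assms by (auto simp: orthonormal_basis_def pairwise_def orthogonal_def norm_eq_1)

lemma orthonormal_basis_expansion:
  assumes B: "orthonormal_basis B S" and x: "x \<in> S"
  shows "x = (\<Sum>e\<in>B. (x \<bullet> e) *\<^sub>R e)"
proof -
  have fin: "finite B" and sp: "span B = S"
    using B by (auto simp: orthonormal_basis_def)
  have orth: "orthogonal (x - (\<Sum>e\<in>B. (x \<bullet> e) *\<^sub>R e)) d" if "d \<in> B" for d
  proof -
    have "(\<Sum>e\<in>B. (x \<bullet> e) *\<^sub>R e) \<bullet> d = (\<Sum>e\<in>B. if e = d then x \<bullet> e else 0)"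
      using that by (auto simp: inner_sum_left orthonormal_basis_inner[OF B] intro!: sum.cong)
    also have "\<dots> = x \<bullet> d"
      using that fin by simp
    finally show ?thesis
      by (simp add: orthogonal_def inner_diff_left)
  qed
  have "x - (\<Sum>e\<in>B. (x \<bullet> e) *\<^sub>R e) \<in> span B"
    using x sp by (auto intro!: span_diff span_sum span_scale intro: span_base)
  then have "orthogonal (x - (\<Sum>e\<in>B. (x \<bullet> e) *\<^sub>R e)) (x - (\<Sum>e\<in>B. (x \<bullet> e) *\<^sub>R e))"
    using orthogonal_to_span[of _ B] orth by blast
  then show ?thesis
    by (simp add: orthogonal_self)
qed

lemma parseval:
  assumes B: "orthonormal_basis B UNIV"
  shows "(\<Sum>e\<in>B. (x \<bullet> e) * (y \<bullet> e)) = x \<bullet> y"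
proof -
  have "x \<bullet> y = (\<Sum>e\<in>B. (x \<bullet> e) *\<^sub>R e) \<bullet> y"
    using orthonormal_basis_expansion[OF B, of x] by simp
  then show ?thesis
    by (simp add: inner_sum_left inner_commute[of y])
qed

text \<open>Both sums are the Hilbert-Schmidt pairing of \<open>f\<close> and \<open>g\<close>: once
  both maps are moved to their adjoints, Parseval eliminates the basis and leaves a sum over the
  fixed \<open>Basis\<close>.\<close>

lemma sum_inner_basis_independent:
  fixes f g :: "'a::euclidean_space \<Rightarrow> 'a"
  assumes f: "linear f" and g: "linear g"
    and B: "orthonormal_basis B UNIV" and C: "orthonormal_basis C UNIV"
  shows "(\<Sum>e\<in>B. f e \<bullet> g e) = (\<Sum>e\<in>C. f e \<bullet> g e)"
proof -
  have *: "(\<Sum>e\<in>B. f e \<bullet> g e) = (\<Sum>k\<in>Basis. adjoint f k \<bullet> adjoint g k)"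
    if B: "orthonormal_basis B UNIV" for B
  proof -
    have "(\<Sum>e\<in>B. f e \<bullet> g e) = (\<Sum>e\<in>B. \<Sum>k\<in>Basis. (f e \<bullet> k) * (g e \<bullet> k))"
      by (simp add: euclidean_inner[symmetric])
    also have "\<dots> = (\<Sum>k\<in>Basis. \<Sum>e\<in>B. (f e \<bullet> k) * (g e \<bullet> k))"
      by (rule sum.swap)
    also have "\<dots> = (\<Sum>k\<in>Basis. \<Sum>e\<in>B. (adjoint f k \<bullet> e) * (adjoint g k \<bullet> e))"
      by (simp add: adjoint_works[OF f] adjoint_works[OF g] inner_commute)
    finally show ?thesis
      by (simp add: parseval[OF B])
  qed
  show ?thesis
    using *[OF B] *[OF C] by simp
qed

text \<open>A zero of a non-negative quadratic form is a minimum, so its first variation vanishes in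
  every direction of \<open>S\<close>.\<close>

lemma nonneg_form_kernel:
  assumes f: "linear f" and sym: "\<And>x y. x \<bullet> f y = f x \<bullet> y" and S: "subspace S"
    and nonneg: "\<And>y. y \<in> S \<Longrightarrow> 0 \<le> y \<bullet> f y"
    and x: "x \<in> S" "x \<bullet> f x = 0" and y: "y \<in> S"
  shows "f x \<bullet> y = 0"
proof -
  define b c where "b = f x \<bullet> y" and "c = y \<bullet> f y"
  have c: "c \<ge> 0"
    using nonneg y by (simp add: c_def)
  \<comment> \<open>For \<open>c > 0\<close> the quadratic \<open>2 t b + t\<^sup>2 c\<close> is
    smallest at \<open>- b / c\<close>. The summand 1 keeps the denominator positive for
    \<open>c = 0\<close>, and the value is still negative unless \<open>b = 0\<close>.\<close>
  define t where "t = - b / (c + 1)"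
  have "0 \<le> (x + t *\<^sub>R y) \<bullet> f (x + t *\<^sub>R y)"
    using nonneg S x y by (simp add: subspace_add subspace_scale)
  also have "\<dots> = 2 * t * b + t\<^sup>2 * c"
    using x sym[of x y] inner_commute[of y "f x"]
    by (simp add: linear_add[OF f] linear_scale[OF f] inner_add_left inner_add_right b_def c_def
        power2_eq_square algebra_simps)
  also have "\<dots> = - (b\<^sup>2 * (c + 2)) / (c + 1)\<^sup>2"
    using c by (simp add: t_def power2_eq_square divide_simps) (simp add: algebra_simps)
  finally have "b\<^sup>2 * (c + 2) \<le> 0"
    using c by (simp add: divide_simps split: if_splits)
  then have "b = 0"
    using c by (auto simp: mult_le_0_iff)
  then show ?thesis
    by (simp add: b_def)
qed

text \<open>Rayleigh quotient and induction on the dimension: if \<open>x\<close> maximises the form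
  on the unit sphere of \<open>S\<close> with value \<open>l\<close>, the form of
  \<open>l - f\<close> is non-negative on \<open>S\<close> and vanishes at \<open>x\<close>, which
  makes \<open>x\<close> an eigenvector; by symmetry its complement in \<open>S\<close> is again
  invariant. Allowing any invariant \<open>S\<close> carries the induction and later gives
  eigenbases of \<open>im p\<close>.\<close>

lemma spectral_basis:
  fixes f :: "'a::euclidean_space \<Rightarrow> 'a"
  assumes f: "linear f" and sym: "\<And>x y. x \<bullet> f y = f x \<bullet> y"
  shows "subspace S \<Longrightarrow> f ` S \<subseteq> S \<Longrightarrow>
    \<exists>B. orthonormal_basis B S \<and> (\<forall>e\<in>B. f e = (e \<bullet> f e) *\<^sub>R e)"
proof (induction "dim S" arbitrary: S rule: less_induct)
  case less
  show ?case
  proof (cases "S = {0}")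
    case True
    then have "orthonormal_basis {} S"
      by (simp add: orthonormal_basis_def)
    then show ?thesis
      by blast
  next
    case False
    then obtain z where z: "z \<in> S" "z \<noteq> 0"
      using less.prems(1) subspace_0 by blast
    let ?K = "sphere 0 1 \<inter> S"
    have "compact ?K"
      using less.prems(1) by (simp add: closed_subspace compact_Int_closed)
    moreover have "z /\<^sub>R norm z \<in> ?K"
      using z less.prems(1) by (simp add: subspace_scale)
    moreover have "continuous_on ?K (\<lambda>x. x \<bullet> f x)"
      using f by (intro continuous_intros linear_continuous_on linear_conv_bounded_linear[THEN iffD1])
    ultimately obtain x where x: "x \<in> ?K" and max: "\<And>y. y \<in> ?K \<Longrightarrow> y \<bullet> f y \<le> x \<bullet> f x"
      using continuous_attains_sup[of ?K "\<lambda>x. x \<bullet> f x"] by blast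
    define l where "l = x \<bullet> f x"
    have xS: "x \<in> S" and nx: "norm x = 1" and xx: "x \<bullet> x = 1"
      using x by (auto simp: norm_eq_1)
    let ?g = "\<lambda>y. l *\<^sub>R y - f y"
    have g: "linear ?g"
      using f by (intro linear_compose_sub linear_compose_scale_right linear_ident)
    have gx0: "?g x \<bullet> y = 0" if "y \<in> S" for y
    proof (rule nonneg_form_kernel[OF g _ less.prems(1) _ xS _ that])
      show "u \<bullet> ?g v = ?g u \<bullet> v" for u v
        by (simp add: inner_diff_left inner_diff_right sym)
      show "x \<bullet> ?g x = 0"
        by (simp add: inner_diff_right xx l_def)
      show "0 \<le> u \<bullet> ?g u" if u: "u \<in> S" for u
      proof (cases "u = 0")
        case False
        have "u /\<^sub>R norm u \<in> ?K"
          using u False less.prems(1) by (simp add: subspace_scale)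
        from max[OF this] have "(u \<bullet> f u) / (norm u)\<^sup>2 \<le> l"
          by (simp add: linear_scale[OF f] l_def power2_eq_square divide_simps)
        then have "u \<bullet> f u \<le> l * (u \<bullet> u)"
          using False by (simp add: divide_simps power2_norm_eq_inner split: if_splits)
        then show ?thesis
          by (simp add: inner_diff_right)
      qed (simp add: linear_0[OF f])
    qed
    \<comment> \<open>\<open>gx0\<close> yields orthogonality to \<open>S\<close> only; invariance
      of \<open>S\<close> makes \<open>?g x\<close> orthogonal to itself.\<close>
    have "?g x \<in> S"
      using less.prems xS by (auto intro!: subspace_diff subspace_scale)
    then have fx: "f x = l *\<^sub>R x"
      using gx0[of "?g x"] by simp
    let ?T = "{y \<in> S. x \<bullet> y = 0}"
    have T: "subspace ?T"
      using less.prems(1) by (auto simp: subspace_def inner_add_right)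
    have fT: "f ` ?T \<subseteq> ?T"
      using less.prems(2) by (auto simp: sym fx)
    have "x \<notin> ?T"
      using xx by simp
    then have "?T \<subset> S"
      using xS by blast
    then have "dim ?T < dim S"
      using T less.prems(1) by (metis dim_psubset span_eq_iff)
    from less.hyps[OF this T fT] obtain B
      where B: "orthonormal_basis B ?T" and eig: "\<forall>e\<in>B. f e = (e \<bullet> f e) *\<^sub>R e"
      by blast
    have BT: "B \<subseteq> ?T"
      using B by (auto simp: orthonormal_basis_def intro: span_base)
    have "span (insert x B) = S"
    proof
      show "span (insert x B) \<subseteq> S"
        using BT xS less.prems(1) by (intro span_minimal) auto
      show "S \<subseteq> span (insert x B)"
      proof
        fix y assume y: "y \<in> S"
        have "y - (x \<bullet> y) *\<^sub>R x \<in> ?T"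
          using y xS xx less.prems(1) by (auto intro!: subspace_diff subspace_scale simp: inner_diff_right)
        then have "y - (x \<bullet> y) *\<^sub>R x \<in> span B"
          using B by (simp add: orthonormal_basis_def)
        then show "y \<in> span (insert x B)"
          using span_breakdown_eq by blast
      qed
    qed
    then have "orthonormal_basis (insert x B) S"
      using B BT nx by (auto simp: orthonormal_basis_def pairwise_insert orthogonal_def inner_commute)
    moreover have "\<forall>e\<in>insert x B. f e = (e \<bullet> f e) *\<^sub>R e"
      using eig fx l_def by simp
    ultimately show ?thesis
      by blast
  qed
qed

section \<open>Complex matrices\<close>

lemma ctranspose_nth [simp]: "ctranspose a $ i $ j = cnj (a $ j $ i)"
  by (simp add: ctranspose_def)

lemma ctranspose_simps [simp]:
  "ctranspose (a + b) = ctranspose a + ctranspose b"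
  "ctranspose (a - b) = ctranspose a - ctranspose b"
  "ctranspose (r *\<^sub>R a) = r *\<^sub>R ctranspose a"
  "ctranspose (ctranspose a) = a"
  "ctranspose (0 :: complex^'n^'m) = 0"
  "ctranspose (mat 1) = mat 1"
  by (auto simp: vec_eq_iff mat_def)

lemma ctranspose_mult: "ctranspose (a ** b) = ctranspose b ** ctranspose a"
  by (simp add: vec_eq_iff matrix_matrix_mult_def mult.commute)

lemma matrix_mult_scaleR [simp]:
  fixes a :: "complex^'n^'m" and b :: "complex^'k^'n"
  shows "(r *\<^sub>R a) ** b = r *\<^sub>R (a ** b)" and "a ** (r *\<^sub>R b) = r *\<^sub>R (a ** b)"
  by (simp_all add: vec_eq_iff matrix_matrix_mult_def scaleR_sum_right)

lemma matrix_mult_diff: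
  fixes a :: "complex^'n^'m"
  shows "(a - b) ** c = a ** c - b ** c" and "d ** (a - b) = d ** a - d ** b"
  by (simp_all add: vec_eq_iff matrix_matrix_mult_def sum_subtractf algebra_simps)

lemma matrix_mult_add_rdistrib:
  fixes a :: "complex^'n^'m"
  shows "(a + b) ** c = a ** c + b ** c"
  by (simp add: vec_eq_iff matrix_matrix_mult_def sum.distrib algebra_simps)

lemma matrix_mult_zero [simp]:
  fixes a :: "complex^'n^'m"
  shows "0 ** a = 0" and "a ** 0 = 0"
  by (simp_all add: vec_eq_iff matrix_matrix_mult_def)

lemma matrix_uminus [simp]:
  fixes a :: "complex^'n^'m"
  shows "ctranspose (- a) = - ctranspose a" and "(- a) *v x = - (a *v x)"
    and "(- a) ** b = - (a ** b)" and "c ** (- a) = - (c ** a)"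
  by (simp_all add: vec_eq_iff matrix_vector_mult_def matrix_matrix_mult_def sum_negf)

lemma scaleR_matrix_vector [simp]:
  fixes a :: "complex^'n^'m"
  shows "(r *\<^sub>R a) *v x = r *\<^sub>R (a *v x)"
  by (simp add: vec_eq_iff matrix_vector_mult_def scaleR_sum_right)

lemma matrix_vector_scaleR [simp]:
  fixes a :: "complex^'n^'m"
  shows "a *v (r *\<^sub>R x) = r *\<^sub>R (a *v x)"
  by (rule linear_scale[OF matrix_vector_mul_linear])

lemma cscale_of_real: "cscale (complex_of_real r) a = r *\<^sub>R a"
  by (simp add: cscale_def vec_eq_iff scaleR_conv_of_real[of _ "_ :: complex"])

lemma bounded_bilinear_matrix_mult:
  "bounded_bilinear ((**) :: complex^'n^'m \<Rightarrow> complex^'k^'n \<Rightarrow> complex^'k^'m)"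
  unfolding bilinear_conv_bounded_bilinear[symmetric] bilinear_def
  by (auto intro!: linearI simp: matrix_add_ldistrib matrix_mult_add_rdistrib)

lemma linear_matrix_vector_left:
  fixes x :: "complex^'n"
  shows "linear (\<lambda>a :: complex^'n^'m. a *v x)"
  by (rule linearI) (simp_all add: matrix_vector_mult_add_rdistrib)

lemma inner_matrix_vector:
  fixes a :: "complex^'n^'m"
  shows "x \<bullet> (a *v y) = (ctranspose a *v x) \<bullet> y"
proof -
  have c: "u \<bullet> (w * v) = (cnj w * u) \<bullet> v" for u v w :: complex
    by (simp add: inner_complex_def algebra_simps)
  have "x \<bullet> (a *v y) = (\<Sum>i\<in>UNIV. \<Sum>j\<in>UNIV. (cnj (a $ i $ j) * x $ i) \<bullet> y $ j)"
    by (simp add: inner_vec_def matrix_vector_mult_def inner_sum_right c)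
  also have "\<dots> = (ctranspose a *v x) \<bullet> y"
    by (subst sum.swap) (simp add: inner_vec_def matrix_vector_mult_def inner_sum_left)
  finally show ?thesis .
qed

lemma inner_matrix_eq_Re_trace:
  fixes a b :: "complex^'n^'n"
  shows "a \<bullet> b = Re (trace (ctranspose a ** b))"
proof -
  have "a \<bullet> b = (\<Sum>i\<in>UNIV. \<Sum>j\<in>UNIV. Re (cnj (a $ i $ j) * b $ i $ j))"
    by (simp add: inner_vec_def inner_complex_def)
  also have "\<dots> = Re (trace (ctranspose a ** b))"
    by (subst sum.swap) (simp add: trace_def matrix_matrix_mult_def)
  finally show ?thesis .
qed

lemma inner_matrix_mult_left:
  fixes a b c :: "complex^'n^'n"
  shows "(a ** b) \<bullet> c = b \<bullet> (ctranspose a ** c)"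
  by (simp add: inner_matrix_eq_Re_trace ctranspose_mult matrix_mul_assoc)

lemma inner_matrix_mult_right:
  fixes a b c :: "complex^'n^'n"
  shows "(a ** b) \<bullet> c = a \<bullet> (c ** ctranspose b)"
proof -
  have "(a ** b) \<bullet> c = Re (trace (ctranspose b ** (ctranspose a ** c)))"
    by (simp add: inner_matrix_eq_Re_trace ctranspose_mult matrix_mul_assoc)
  also have "\<dots> = Re (trace ((ctranspose a ** c) ** ctranspose b))"
    by (subst trace_mul_sym) simp
  finally show ?thesis
    by (simp add: inner_matrix_eq_Re_trace matrix_mul_assoc)
qed

lemma trace_self_adjoint:
  fixes a :: "complex^'n^'n"
  assumes "ctranspose a = a"
  shows "trace a = complex_of_real (a \<bullet> mat 1)"
  using inner_eq_trace[OF assms, of "mat 1"] by simp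

lemma inner_matrix_sum_Basis:
  fixes a b :: "complex^'n^'n"
  shows "(\<Sum>e\<in>Basis. (a *v e) \<bullet> (b *v e)) = 2 * (a \<bullet> b)"
proof -
  have mv: "(a *v axis i u) $ j = a $ j $ i * u" for a :: "complex^'n^'n" and i j u
    by (simp add: matrix_vector_mult_def axis_def if_distrib cong: if_cong)
  have ax: "(a *v axis i u) \<bullet> (b *v axis i u) = (norm u)\<^sup>2 * (\<Sum>j\<in>UNIV. a $ j $ i \<bullet> b $ j $ i)" for i u
  proof -
    have "(x * u) \<bullet> (y * u) = (norm u)\<^sup>2 * (x \<bullet> y)" for x y :: complex
      by (simp add: inner_complex_def cmod_power2) algebra
    then show ?thesis
      by (simp add: inner_vec_def mv sum_distrib_left)
  qed
  have Basis: "(Basis :: (complex^'n) set) = (\<lambda>(i, u). axis i u) ` (UNIV \<times> Basis)"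
    by (auto simp: Basis_vec_def)
  have inj: "inj_on (\<lambda>(i, u). axis i u :: complex^'n) (UNIV \<times> Basis)"
    by (auto simp: inj_on_def axis_eq_axis)
  have "(\<Sum>e\<in>Basis. (a *v e) \<bullet> (b *v e)) =
      (\<Sum>(i, u)\<in>UNIV \<times> Basis. (a *v axis i u) \<bullet> (b *v axis i u))"
    unfolding Basis by (subst sum.reindex[OF inj]) (simp add: case_prod_beta)
  also have "\<dots> = (\<Sum>i\<in>UNIV. \<Sum>u\<in>Basis. (a *v axis i u) \<bullet> (b *v axis i u))"
    by (simp add: sum.cartesian_product)
  also have "\<dots> = (\<Sum>i\<in>UNIV. 2 * (\<Sum>j\<in>UNIV. a $ j $ i \<bullet> b $ j $ i))"
    by (simp add: ax Basis_complex_def)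
  also have "\<dots> = 2 * (\<Sum>j\<in>UNIV. \<Sum>i\<in>UNIV. a $ j $ i \<bullet> b $ j $ i)"
    by (subst sum.swap) (simp add: sum_distrib_left)
  finally show ?thesis
    by (simp add: inner_vec_def)
qed

text \<open>The factor 2 arises because the real trace of a complex matrix is twice its trace.\<close>

lemma inner_matrix_orthonormal_basis:
  fixes a b :: "complex^'n^'n"
  assumes "orthonormal_basis B UNIV"
  shows "2 * (a \<bullet> b) = (\<Sum>e\<in>B. (a *v e) \<bullet> (b *v e))"
  using sum_inner_basis_independent[OF _ _ assms orthonormal_basis_Basis, of "(*v) a" "(*v) b"]
  by (simp add: inner_matrix_sum_Basis)

text \<open>A separate eigenbasis for each matrix copes with matrices that do not commute: the
  pairing becomes a sum over pairs of eigenvalues with weights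
  \<open>(e \<bullet> c)\<^sup>2\<close>, so scalar inequalities carry over term by term.\<close>

lemma inner_matrix_eigenbases:
  fixes a b :: "complex^'n^'n"
  assumes B: "orthonormal_basis B UNIV" and a: "\<And>e. e \<in> B \<Longrightarrow> a *v e = \<alpha> e *\<^sub>R e"
    and C: "orthonormal_basis C UNIV" and b: "\<And>c. c \<in> C \<Longrightarrow> b *v c = \<beta> c *\<^sub>R c"
  shows "2 * (a \<bullet> b) = (\<Sum>e\<in>B. \<Sum>c\<in>C. \<alpha> e * \<beta> c * (e \<bullet> c)\<^sup>2)"
proof -
  have "e \<bullet> (b *v e) = (\<Sum>c\<in>C. \<beta> c * (e \<bullet> c)\<^sup>2)" for e
  proof -
    have "b *v e = b *v (\<Sum>c\<in>C. (e \<bullet> c) *\<^sub>R c)"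
      using orthonormal_basis_expansion[OF C, of e] by simp
    also have "\<dots> = (\<Sum>c\<in>C. (e \<bullet> c) *\<^sub>R (\<beta> c *\<^sub>R c))"
      by (simp add: linear_sum[OF matrix_vector_mul_linear] b)
    finally show ?thesis
      by (simp add: inner_sum_right power2_eq_square mult_ac)
  qed
  then show ?thesis
    by (simp add: inner_matrix_orthonormal_basis[OF B] a sum_distrib_left mult.assoc)
qed

lemma self_adjoint_eigenbasis:
  fixes a :: "complex^'n^'n"
  assumes "ctranspose a = a" "subspace S" "\<And>x. x \<in> S \<Longrightarrow> a *v x \<in> S"
  shows "\<exists>B \<alpha>. orthonormal_basis B S \<and> (\<forall>e\<in>B. a *v e = \<alpha> e *\<^sub>R e)"
proof -
  have "\<exists>B. orthonormal_basis B S \<and> (\<forall>e\<in>B. a *v e = (e \<bullet> (a *v e)) *\<^sub>R e)"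
    using inner_matrix_vector[of _ a] assms by (intro spectral_basis) auto
  then obtain B where "orthonormal_basis B S" "\<forall>e\<in>B. a *v e = (e \<bullet> (a *v e)) *\<^sub>R e"
    by (elim exE conjE)
  then show ?thesis
    by (intro exI[of _ B] exI[of _ "\<lambda>e. e \<bullet> (a *v e)"] conjI)
qed

lemma matrix_eqI_span:
  fixes a b :: "complex^'n^'n"
  assumes "span B = UNIV" "\<And>e. e \<in> B \<Longrightarrow> a *v e = b *v e"
  shows "a = b"
  using linear_eq_on_span[of "(*v) a" "(*v) b" B] assms by (auto simp: matrix_eq)

text \<open>In an eigenbasis of \<open>a\<close>, the pairing combines values of the form of
  \<open>b\<close> with the non-negative eigenvalues of \<open>a\<close> as coefficients.\<close>

lemma psd_inner_nonneg:
  fixes a b :: "complex^'n^'n"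
  assumes a: "psd a" and b: "psd b"
  shows "0 \<le> a \<bullet> b"
proof -
  have "ctranspose a = a"
    using a by (simp add: psd_def)
  then obtain B \<alpha> where B: "orthonormal_basis B UNIV" and e: "\<forall>e\<in>B. a *v e = \<alpha> e *\<^sub>R e"
    using self_adjoint_eigenbasis[OF _ subspace_UNIV] by blast
  have \<alpha>: "\<alpha> e \<ge> 0" if "e \<in> B" for e
  proof -
    have "0 \<le> e \<bullet> (a *v e)"
      using a by (simp add: psd_def)
    then show ?thesis
      using e that orthonormal_basis_inner[OF B that that] by simp
  qed
  have "2 * (a \<bullet> b) = (\<Sum>e\<in>B. \<alpha> e * (e \<bullet> (b *v e)))"
    using e by (simp add: inner_matrix_orthonormal_basis[OF B])
  also have "\<dots> \<ge> 0"
    using \<alpha> b by (auto simp: psd_def intro!: sum_nonneg)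
  finally show ?thesis
    by simp
qed

lemma psd_kernel:
  assumes "psd a" "x \<bullet> (a *v x) = 0"
  shows "a *v x = 0"
proof -
  have "(a *v x) \<bullet> (a *v x) = 0"
    using assms inner_matrix_vector[of _ a]
    by (intro nonneg_form_kernel[OF matrix_vector_mul_linear _ subspace_UNIV])
       (auto simp: psd_def)
  then show ?thesis
    by simp
qed

lemma psd_mat_1: "psd (mat 1)"
  by (simp add: psd_def)

lemma psd_trace_zero:
  fixes a :: "complex^'n^'n"
  assumes a: "psd a" and 0: "a \<bullet> mat 1 = 0"
  shows "a = 0"
proof -
  have "(\<Sum>e\<in>Basis. (a *v e) \<bullet> e) = 0"
    using inner_matrix_sum_Basis[of a "mat 1"] 0 by simp
  then have "\<forall>e\<in>Basis. (a *v e) \<bullet> e = 0"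
    using a by (subst (asm) sum_nonneg_eq_0_iff) (auto simp: psd_def inner_commute)
  then have "a *v e = 0" if "e \<in> Basis" for e
    using psd_kernel[OF a] that by (simp add: inner_commute)
  then show ?thesis
    by (intro matrix_eqI_span[OF span_Basis]) simp
qed

section \<open>Images, kernels and orthogonal projections\<close>

lemma im_projection:
  assumes "projection p"
  shows "im p = {x. p *v x = x}"
proof -
  have "p *v (p *v x) = p *v x" for x
    using assms by (simp add: projection_def matrix_vector_mul_assoc)
  then show ?thesis
    unfolding im_def by auto (metis rangeI)
qed

lemma subspace_im: "subspace (im a)"
  unfolding im_def by (intro linear_subspace_image) auto

lemma im_orthogonal_kernel:
  fixes a :: "complex^'n^'n"
  assumes a: "ctranspose a = a"
  shows "(\<forall>y\<in>im a. x \<bullet> y = 0) \<longleftrightarrow> a *v x = 0"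
proof
  assume "\<forall>y\<in>im a. x \<bullet> y = 0"
  then have "x \<bullet> (a *v (a *v x)) = 0"
    by (auto simp: im_def)
  then show "a *v x = 0"
    using a inner_matrix_vector[of x a "a *v x"] by simp
next
  assume "a *v x = 0"
  then show "\<forall>y\<in>im a. x \<bullet> y = 0"
    using a by (auto simp: im_def inner_matrix_vector)
qed

text \<open>The kernel of a Hermitian matrix is the orthogonal complement of its image, so
  inclusions reverse. Support conditions can then be checked on single vectors.\<close>

lemma im_subset_iff_kernel:
  fixes a b :: "complex^'n^'n"
  assumes a: "ctranspose a = a" and b: "ctranspose b = b"
  shows "im a \<subseteq> im b \<longleftrightarrow> (\<forall>x. b *v x = 0 \<longrightarrow> a *v x = 0)"
proof
  assume "im a \<subseteq> im b"
  then show "\<forall>x. b *v x = 0 \<longrightarrow> a *v x = 0"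
    using im_orthogonal_kernel[OF a] im_orthogonal_kernel[OF b] by blast
next
  assume k: "\<forall>x. b *v x = 0 \<longrightarrow> a *v x = 0"
  show "im a \<subseteq> im b"
  proof
    fix x assume x: "x \<in> im a"
    obtain y z where y: "y \<in> im b" and z: "\<And>w. w \<in> im b \<Longrightarrow> orthogonal z w" and xyz: "x = y + z"
      using orthogonal_subspace_decomp_exists[of "im b" x] subspace_im[of b] span_eq_iff by metis
    have "b *v z = 0"
      using z im_orthogonal_kernel[OF b, of z] by (auto simp: orthogonal_def)
    then have "z \<bullet> x = 0"
      using k x im_orthogonal_kernel[OF a, of z] by blast
    moreover have "z \<bullet> y = 0"
      using z[OF y] by (simp add: orthogonal_def)
    ultimately show "x \<in> im b"
      using y by (simp add: xyz inner_add_right)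
  qed
qed

text \<open>The inclusion gives \<open>p ** a = a\<close>; conjugate transposition supplies the
  factor on the right. This turns the support condition of the relative entropy into membership in
  the compressed algebra.\<close>

lemma im_subset_projection:
  fixes a p :: "complex^'n^'n"
  assumes p: "projection p" and a: "ctranspose a = a"
  shows "im a \<subseteq> im p \<longleftrightarrow> p ** a ** p = a"
proof
  assume "im a \<subseteq> im p"
  then have "p *v (a *v x) = a *v x" for x
    unfolding im_projection[OF p] by (auto simp: im_def)
  then have pa: "p ** a = a"
    by (simp add: matrix_eq matrix_vector_mul_assoc)
  then have "a ** p = a"
    using a p by (metis ctranspose_mult projection_def)
  then show "p ** a ** p = a"
    by (simp add: pa)
next
  assume "p ** a ** p = a"
  then have "a *v x = p *v ((a ** p) *v x)" for x
    by (metis matrix_mul_assoc matrix_vector_mul_assoc)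
  then show "im a \<subseteq> im p"
    by (auto simp: im_def)
qed

lemma projection_eqI:
  fixes p q :: "complex^'n^'n"
  assumes p: "projection p" and q: "projection q" and im: "im p = im q"
  shows "p = q"
proof -
  have "q ** p = p"
    using im unfolding im_projection[OF q]
    by (force simp: matrix_eq matrix_vector_mul_assoc[symmetric] im_def)
  moreover have "p ** q = q"
    using im unfolding im_projection[OF p]
    by (force simp: matrix_eq matrix_vector_mul_assoc[symmetric] im_def)
  ultimately show ?thesis
    using p q by (metis ctranspose_mult projection_def)
qed

text \<open>Orthogonality refers to the real inner product, so the projection is at first only real
  linear. A scalar \<open>c\<close> moves across the inner product as \<open>cnj c\<close>, which
  preserves \<open>S\<close> by \<open>i\<close>; hence the projection is complex linear and given
  by a matrix.\<close>

lemma projection_onto_exists: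
  fixes S :: "(complex^'n) set"
  assumes S: "subspace S" and i: "\<And>c x. x \<in> S \<Longrightarrow> c *s x \<in> S"
  obtains p :: "complex^'n^'n" where "projection p" "im p = S"
proof -
  have "\<exists>y. y \<in> S \<and> (\<forall>w\<in>S. (x - y) \<bullet> w = 0)" for x
    using orthogonal_subspace_decomp_exists[of S x] S
    by (metis add_diff_cancel_left' orthogonal_def span_eq_iff)
  then obtain f where fS: "\<And>x. f x \<in> S" and f: "\<And>x w. w \<in> S \<Longrightarrow> (x - f x) \<bullet> w = 0"
    by metis
  have uniq: "f x = y" if y: "y \<in> S" "\<And>w. w \<in> S \<Longrightarrow> (x - y) \<bullet> w = 0" for x y
  proof -
    have d: "f x - y \<in> S"
      using fS y S by (auto intro: subspace_diff)
    have "(f x - y) \<bullet> (f x - y) = (x - y) \<bullet> (f x - y) - (x - f x) \<bullet> (f x - y)"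
      by (simp add: inner_diff_left)
    then show ?thesis
      using f[OF d] y(2)[OF d] by simp
  qed
  have cadj: "(c *s x) \<bullet> w = x \<bullet> (cnj c *s w)" for c and x w :: "complex^'n"
    by (auto simp: inner_vec_def inner_complex_def algebra_simps intro!: sum.cong)
  have f_add: "f (x + y) = f x + f y" for x y
  proof (rule uniq)
    show "f x + f y \<in> S"
      using fS S by (auto intro: subspace_add)
    show "(x + y - (f x + f y)) \<bullet> w = 0" if "w \<in> S" for w
      using f[OF that, of x] f[OF that, of y] by (simp add: inner_diff_left inner_add_left)
  qed
  have f_scale: "f (c *s x) = c *s f x" for c x
  proof (rule uniq)
    show "c *s f x \<in> S"
      using fS i by blast
    show "(c *s x - c *s f x) \<bullet> w = 0" if "w \<in> S" for w
    proof -
      have "c *s x - c *s f x = c *s (x - f x)"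
        by (rule vector_ssub_ldistrib[symmetric])
      then show ?thesis
        using f[OF i[OF that, of "cnj c"], of x] by (simp only: cadj)
    qed
  qed
  have "Vector_Spaces.linear (*s) (*s) f"
    by unfold_locales (simp_all add: f_add f_scale)
  then have m: "matrix f *v x = f x" for x
    by (simp add: matrix_works)
  have ff: "f x = x" if "x \<in> S" for x
    using that by (intro uniq) auto
  have "ctranspose (matrix f) *v x = matrix f *v x" for x
  proof -
    have "y \<bullet> (ctranspose (matrix f) *v x) = y \<bullet> f x" for y
    proof -
      have "y \<bullet> (ctranspose (matrix f) *v x) = f y \<bullet> x"
        by (simp add: inner_matrix_vector m)
      also have "\<dots> = f y \<bullet> f x"
        using f[OF fS[of y], of x] by (simp add: inner_diff_left inner_diff_right inner_commute)
      also have "\<dots> = y \<bullet> f x"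
        using f[OF fS[of x], of y] by (simp add: inner_diff_left)
      finally show ?thesis .
    qed
    then show ?thesis
      by (metis m vector_eq_rdot inner_commute)
  qed
  then have "ctranspose (matrix f) = matrix f"
    by (simp add: matrix_eq)
  moreover have "matrix f ** matrix f = matrix f"
    by (simp add: matrix_eq matrix_vector_mul_assoc[symmetric] m ff fS)
  ultimately have p: "projection (matrix f)"
    by (simp add: projection_def)
  have "(*v) (matrix f) = f"
    by (rule ext) (rule m)
  then have "im (matrix f) = S"
    using fS ff by (auto simp: im_def) (metis rangeI)
  with p that show ?thesis
    by blast
qed

section \<open>Eigenspaces and the logarithm\<close>

lemma eigenspace_iff: "x \<in> eigenspace a l \<longleftrightarrow> a *v x = l *\<^sub>R x"
proof -
  have "complex_of_real l *s x = l *\<^sub>R x"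
    by (simp add: vec_eq_iff scaleR_conv_of_real[of _ "_ :: complex"])
  then show ?thesis
    by (simp add: eigenspace_def)
qed

lemma spectral_proj:
  fixes a :: "complex^'n^'n"
  shows "projection (spectral_proj a l)" and "im (spectral_proj a l) = eigenspace a l"
proof -
  have cs: "a *v (c *s x) = c *s (a *v x)" for c x
    by (simp add: vector_scalar_commute)
  have "subspace (eigenspace a l)"
    by (auto simp: subspace_def eigenspace_iff matrix_vector_right_distrib scaleR_right_distrib)
  moreover have "c *s x \<in> eigenspace a l" if "x \<in> eigenspace a l" for c x
    using that by (simp add: eigenspace_def cs mult.commute)
  ultimately obtain p :: "complex^'n^'n" where "projection p" "im p = eigenspace a l"
    using projection_onto_exists by blast
  then have "\<exists>!p. projection p \<and> im p = eigenspace a l"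
    using projection_eqI by metis
  from theI'[OF this] show "projection (spectral_proj a l)" "im (spectral_proj a l) = eigenspace a l"
    by (simp_all add: spectral_proj_def)
qed

lemma eigenvectors_orthogonal:
  fixes a :: "complex^'n^'n"
  assumes "ctranspose a = a" "a *v x = l *\<^sub>R x" "a *v y = m *\<^sub>R y" "l \<noteq> m"
  shows "x \<bullet> y = 0"
  using inner_matrix_vector[of x a y] assms by simp

text \<open>A sum over an infinite index set would be 0 by convention, so \<open>mlog\<close> has
  its intended meaning only through this fact. An eigenvector has a non-zero component along some
  basis vector, and different eigenvalues have orthogonal eigenvectors.\<close>

lemma finite_eigenvalues:
  fixes a :: "complex^'n^'n"
  assumes a: "ctranspose a = a"
  shows "finite {l. eigenspace a l \<noteq> {0}}"
proof -
  obtain B \<alpha> where B: "orthonormal_basis B UNIV" and e: "\<forall>e\<in>B. a *v e = \<alpha> e *\<^sub>R e"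
    using self_adjoint_eigenbasis[OF a subspace_UNIV] by blast
  have "{l. eigenspace a l \<noteq> {0}} \<subseteq> \<alpha> ` B"
  proof
    fix l assume "l \<in> {l. eigenspace a l \<noteq> {0}}"
    moreover have "0 \<in> eigenspace a l"
      by (simp add: eigenspace_iff)
    ultimately obtain x where "x \<in> eigenspace a l" and x0: "x \<noteq> 0"
      by blast
    then have x: "a *v x = l *\<^sub>R x"
      by (simp add: eigenspace_iff)
    have "\<exists>e\<in>B. x \<bullet> e \<noteq> 0"
    proof (rule ccontr)
      assume "\<not> ?thesis"
      then have "x = 0"
        using orthonormal_basis_expansion[OF B, of x] by simp
      with x0 show False ..
    qed
    then obtain d where d: "d \<in> B" "x \<bullet> d \<noteq> 0"
      by blast
    then have "l = \<alpha> d"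
      using eigenvectors_orthogonal[OF a x e[rule_format]] by blast
    with d show "l \<in> \<alpha> ` B"
      by blast
  qed
  then show ?thesis
    using B by (meson finite_imageI finite_subset orthonormal_basis_def)
qed

text \<open>The value \<open>l = 0\<close> is covered by the convention \<open>ln 0 = 0\<close>,
  which agrees with the extension by 0 on the kernel.\<close>

lemma mlog_eigenvector:
  fixes a :: "complex^'n^'n"
  assumes a: "ctranspose a = a" and x: "a *v x = l *\<^sub>R x" and l: "0 \<le> l"
  shows "mlog a *v x = ln l *\<^sub>R x"
proof (cases "x = 0")
  case False
  let ?L = "{l. 0 < l \<and> eigenspace a l \<noteq> {0}}"
  have fin: "finite ?L"
    using finite_eigenvalues[OF a] by (rule rev_finite_subset) auto
  have sp: "spectral_proj a m *v x = (if m = l then x else 0)" for m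
  proof (cases "m = l")
    case True
    then show ?thesis
      using x im_projection[OF spectral_proj(1)[of a l]] spectral_proj(2)[of a l]
        eigenspace_iff[of x a l] by auto
  next
    case False
    have "\<forall>y\<in>im (spectral_proj a m). x \<bullet> y = 0"
      unfolding spectral_proj(2) eigenspace_iff
      by (intro ballI eigenvectors_orthogonal[OF a x]) (use False in \<open>auto simp: eigenspace_iff\<close>)
    then show ?thesis
      using im_orthogonal_kernel[of "spectral_proj a m" x] spectral_proj(1)[of a m] False
      by (auto simp: projection_def)
  qed
  have "mlog a *v x = (\<Sum>m\<in>?L. ln m *\<^sub>R (spectral_proj a m *v x))"
    unfolding mlog_def by (simp add: linear_sum[OF linear_matrix_vector_left])
  also have "\<dots> = (\<Sum>m\<in>?L. if m = l then ln l *\<^sub>R x else 0)"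
    by (intro sum.cong) (auto simp: sp)
  also have "\<dots> = (if l \<in> ?L then ln l *\<^sub>R x else 0)"
    using fin by simp
  also have "\<dots> = ln l *\<^sub>R x"
    using x False l eigenspace_iff[of x a l] by auto
  finally show ?thesis .
qed simp

section \<open>Support projections inside the algebra\<close>

lemma subspace_cstar_subalgebra:
  assumes "cstar_subalgebra A"
  shows "subspace A"
  unfolding subspace_def
proof (intro conjI ballI allI)
  fix r :: real and a assume "a \<in> A"
  then have "cscale (complex_of_real r) a \<in> A"
    using assms unfolding cstar_subalgebra_def by blast
  then show "r *\<^sub>R a \<in> A"
    by (simp add: cscale_of_real)
qed (use assms in \<open>auto simp: cstar_subalgebra_def\<close>)

lemma support_projection:
  fixes t :: "complex^'n^'n"
  obtains p where "projection p" "im p = im t"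
proof (rule projection_onto_exists[OF subspace_im])
  show "c *s x \<in> im t" if "x \<in> im t" for c x
    using that by (auto simp: im_def vector_scalar_commute[symmetric])
qed

text \<open>
  The difference \<open>d\<close> of \<open>p\<close> and its orthogonal projection to \<open>A\<close> satisfies
  \<open>norm (d t)\<^sup>2 = d \<bullet> (d t t) = 0\<close>, because \<open>d t t\<close> lies in \<open>A\<close>; hence \<open>d p = 0\<close>
  and \<open>norm d\<^sup>2 = d \<bullet> p = 0\<close>.
\<close>

lemma support_projection_in_algebra:
  fixes t p :: "complex^'n^'n"
  assumes A: "cstar_subalgebra A" and t: "t \<in> A" "ctranspose t = t"
    and p: "projection p" "im p = im t"
  shows "p \<in> A"
proof -
  have sub: "subspace A"
    using A by (rule subspace_cstar_subalgebra)
  obtain w d where w: "w \<in> A" and d: "\<And>x. x \<in> A \<Longrightarrow> orthogonal d x" and pwd: "p = w + d"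
    using orthogonal_subspace_decomp_exists[of A p] span_eq_iff[THEN iffD2, OF sub] by metis
  have mult: "\<And>x y. x \<in> A \<Longrightarrow> y \<in> A \<Longrightarrow> x ** y \<in> A"
    using A by (simp add: cstar_subalgebra_def)
  have pt: "p ** t = t"
    using p(2) unfolding im_projection[OF p(1)]
    by (force simp: matrix_eq matrix_vector_mul_assoc[symmetric] im_def)
  have "d ** t ** t = (p - w) ** t ** t"
    using pwd by simp
  also have "\<dots> = t ** t - w ** t ** t"
    by (simp add: matrix_mult_diff pt)
  also have "\<dots> \<in> A"
    using sub mult t(1) w by (intro subspace_diff) auto
  finally have "d \<bullet> (d ** t ** t) = 0"
    using d by (simp add: orthogonal_def)
  then have "(d ** t) \<bullet> (d ** t) = 0"
    by (simp add: inner_matrix_mult_right t(2))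
  then have dt: "d ** t = 0"
    by simp
  have "d *v (p *v x) = 0" for x
  proof -
    have "p *v x \<in> im t"
      using p(2) by (auto simp: im_def)
    then obtain y where y: "p *v x = t *v y"
      by (auto simp: im_def)
    show ?thesis
      unfolding y by (simp add: matrix_vector_mul_assoc dt)
  qed
  then have dp: "d ** p = 0"
    by (simp add: matrix_eq matrix_vector_mul_assoc[symmetric])
  have "d \<bullet> d = d \<bullet> p"
    using d[OF w] pwd by (simp add: orthogonal_def inner_add_right)
  also have "\<dots> = (d ** p) \<bullet> mat 1"
    using p(1) by (simp add: inner_matrix_mult_right projection_def)
  finally have "d = 0"
    by (simp add: dp)
  then show ?thesis
    using w pwd by simp
qed

section \<open>The exponential\<close>

text \<open>The identity of the compressed algebra is an explicit argument instead of the
  description \<open>alg_one\<close>. It is merely an additive constant, so statements on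
  differences of exponentials can be proved for \<open>mat 1\<close> and transferred.\<close>

definition pexp :: "complex^'n^'n \<Rightarrow> complex^'n^'n \<Rightarrow> complex^'n^'n"
  where "pexp p a = p + (\<Sum>i. (1 / fact (Suc i)) *\<^sub>R mpow a (Suc i))"

lemma alg_exp_eq_pexp: "alg_exp A a = pexp (alg_one A) a"
  by (simp add: alg_exp_def pexp_def)

lemma mpow_Suc_right: "mpow a (Suc k) = mpow a k ** a"
  by (induction k) (simp_all add: matrix_mul_assoc)

lemma ctranspose_mpow: "ctranspose a = a \<Longrightarrow> ctranspose (mpow a k) = mpow a k"
proof (induction k)
  case (Suc k)
  then have "ctranspose (mpow a (Suc k)) = mpow a k ** a"
    by (simp add: ctranspose_mult)
  then show ?case
    by (simp only: mpow_Suc_right)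
qed simp

text \<open>\<open>K\<close> is the bound of matrix multiplication as a bilinear map. It does not
  depend on \<open>a\<close>, which makes the estimate uniform on balls.\<close>

lemma norm_mpow_le:
  "\<exists>K>0. \<forall>a :: complex^'n^'n. \<forall>R k. norm a \<le> R \<longrightarrow> norm (mpow a k) \<le> norm (mat 1 :: complex^'n^'n) * (R * K) ^ k"
proof -
  obtain K where K: "K > 0" "\<And>(a :: complex^'n^'n) (b :: complex^'n^'n). norm (a ** b) \<le> norm a * norm b * K"
    using bounded_bilinear.pos_bounded[OF bounded_bilinear_matrix_mult] by metis
  have "norm (mpow a k) \<le> norm (mat 1 :: complex^'n^'n) * (R * K) ^ k"
    if a: "norm a \<le> R" for a :: "complex^'n^'n" and R k
  proof (induction k)
    case (Suc k)
    have R: "R \<ge> 0"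
      using a norm_ge_zero order_trans by blast
    have "norm (mpow a (Suc k)) \<le> norm a * norm (mpow a k) * K"
      using K(2) by simp
    also have "\<dots> \<le> R * (norm (mat 1 :: complex^'n^'n) * (R * K) ^ k) * K"
      using Suc a R K(1) by (intro mult_right_mono mult_mono) auto
    finally show ?case
      by (simp add: mult_ac)
  qed simp
  with K(1) show ?thesis
    by blast
qed

text \<open>One majorant for the whole ball gives both summability and, by the Weierstrass test,
  continuity of the exponential.\<close>

lemma pexp_uniform:
  "\<exists>M. summable M \<and> (\<forall>a :: complex^'n^'n. \<forall>i. norm a \<le> R \<longrightarrow>
    norm ((1 / fact (Suc i)) *\<^sub>R mpow a (Suc i)) \<le> M i)"
proof -
  obtain K where K: "K > 0"
    and le: "\<forall>a :: complex^'n^'n. \<forall>R k. norm a \<le> R \<longrightarrow> norm (mpow a k) \<le> norm (mat 1 :: complex^'n^'n) * (R * K) ^ k"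
    using norm_mpow_le by (elim exE conjE)
  define M where "M i = norm (mat 1 :: complex^'n^'n) * (inverse (fact (Suc i)) * (R * K) ^ Suc i)" for i
  have "norm ((1 / fact (Suc i)) *\<^sub>R mpow a (Suc i)) \<le> M i" if "norm a \<le> R" for a :: "complex^'n^'n" and i
  proof -
    have "norm ((1 / fact (Suc i)) *\<^sub>R mpow a (Suc i)) = inverse (fact (Suc i)) * norm (mpow a (Suc i))"
      by (simp add: inverse_eq_divide del: mpow.simps fact_Suc)
    also have "\<dots> \<le> inverse (fact (Suc i)) * (norm (mat 1 :: complex^'n^'n) * (R * K) ^ Suc i)"
      using le[rule_format, OF that, of "Suc i"] by (intro mult_left_mono) (simp_all del: fact_Suc mpow.simps)
    finally show ?thesis
      by (simp only: M_def mult_ac)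
  qed
  moreover have "summable M"
    unfolding M_def
    by (intro summable_mult iffD2[OF summable_Suc_iff[of "\<lambda>i. inverse (fact i) * (R * K) ^ i"]] summable_exp)
  ultimately show ?thesis
    by (intro exI[of _ M]) simp
qed

lemma pexp_summable: "summable (\<lambda>i. (1 / fact (Suc i)) *\<^sub>R mpow (a :: complex^'n^'n) (Suc i))"
proof -
  obtain M where "summable M" and M: "\<forall>b :: complex^'n^'n. \<forall>i. norm b \<le> norm a \<longrightarrow>
      norm ((1 / fact (Suc i)) *\<^sub>R mpow b (Suc i)) \<le> M i"
    using pexp_uniform[of "norm a"] by (elim exE conjE)
  from this(1) show ?thesis
    by (rule summable_comparison_test') (rule M[rule_format, OF order_refl])
qed

lemma continuous_on_mpow: "continuous_on S (\<lambda>a :: complex^'n^'n. mpow a k)"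
proof (induction k)
  case (Suc k)
  then show ?case
    by (simp add: bounded_bilinear.continuous_on[OF bounded_bilinear_matrix_mult])
qed simp

lemma continuous_on_pexp: "continuous_on UNIV (pexp (p :: complex^'n^'n))"
proof -
  let ?f = "\<lambda>a :: complex^'n^'n. \<Sum>i. (1 / fact (Suc i)) *\<^sub>R mpow a (Suc i)"
  have cb: "continuous_on (cball 0 R) ?f" for R
  proof -
    obtain M where "summable M" and M: "\<forall>a :: complex^'n^'n. \<forall>i. norm a \<le> R \<longrightarrow>
        norm ((1 / fact (Suc i)) *\<^sub>R mpow a (Suc i)) \<le> M i"
      using pexp_uniform[of R] by (elim exE conjE)
    have ul: "uniform_limit (cball 0 R) (\<lambda>n a :: complex^'n^'n. \<Sum>i<n. (1 / fact (Suc i)) *\<^sub>R mpow a (Suc i)) ?f sequentially"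
    proof (rule Weierstrass_m_test)
      show "norm ((1 / fact (Suc i)) *\<^sub>R mpow a (Suc i)) \<le> M i" if "a \<in> cball 0 R" for i and a :: "complex^'n^'n"
        using M[rule_format, of a] that by (simp del: mpow.simps)
    qed fact
    have c: "continuous_on (cball 0 R) (\<lambda>a :: complex^'n^'n. \<Sum>i<n. (1 / fact (Suc i)) *\<^sub>R mpow a (Suc i))" for n
      by (intro continuous_on_sum continuous_on_scaleR continuous_on_const continuous_on_mpow)
    show ?thesis
      by (rule uniform_limit_theorem[OF always_eventually[OF allI[OF c]] ul sequentially_bot])
  qed
  have "isCont ?f a" for a
    by (rule continuous_on_interior[OF cb[of "norm a + 1"]]) (simp add: interior_cball)
  then have "continuous_on UNIV ?f"
    by (simp add: continuous_on_eq_continuous_at del: mpow.simps)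
  then show ?thesis
    unfolding pexp_def by (intro continuous_on_add continuous_on_const)
qed

text \<open>Subspaces are closed here, so the series stays inside. Only powers from the first on
  occur, since \<open>mat 1\<close> may lie outside \<open>V\<close>. It is applied to the algebra,
  to the Hermitian matrices and to the matrices fixed by a compression.\<close>

lemma pexp_in_subspace:
  fixes a :: "complex^'n^'n"
  assumes V: "subspace V" and p: "p \<in> V" and m: "\<And>i. mpow a (Suc i) \<in> V"
  shows "pexp p a \<in> V"
proof -
  have "(\<Sum>i<n. (1 / fact (Suc i)) *\<^sub>R mpow a (Suc i)) \<in> V" for n
    by (intro subspace_sum subspace_scale V m)
  then have "(\<Sum>i. (1 / fact (Suc i)) *\<^sub>R mpow a (Suc i)) \<in> V"
    by (rule closed_sequentially[OF closed_subspace[OF V] _ summable_LIMSEQ[OF pexp_summable]])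
  then show ?thesis
    using V p by (simp add: pexp_def subspace_add del: mpow.simps)
qed

text \<open>The subtracted 1 is the constant term missing from the series; where
  \<open>p *v v = v\<close>, the two parts add up to \<open>exp r *\<^sub>R v\<close>.\<close>

lemma pexp_eigenvector:
  fixes a :: "complex^'n^'n"
  assumes v: "a *v v = r *\<^sub>R v"
  shows "pexp p a *v v = p *v v + (exp r - 1) *\<^sub>R v"
proof -
  have m: "mpow a k *v v = r ^ k *\<^sub>R v" for k
  proof (induction k)
    case (Suc k)
    then show ?case
      by (simp add: v matrix_vector_mul_assoc[symmetric] mult.commute)
  qed simp
  have bl: "bounded_linear (\<lambda>b :: complex^'n^'n. b *v v)"
    using linear_matrix_vector_left by (simp add: linear_conv_bounded_linear)
  have "(\<lambda>i. r ^ Suc i /\<^sub>R fact (Suc i)) sums (exp r - 1)"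
    using exp_converges[of r] by (subst sums_Suc_iff) simp
  then have "(\<lambda>i. (r ^ Suc i /\<^sub>R fact (Suc i)) *\<^sub>R v) sums ((exp r - 1) *\<^sub>R v)"
    by (rule bounded_linear.sums[OF bounded_linear_scaleR_left])
  then have "(\<lambda>i. ((1 / fact (Suc i)) *\<^sub>R mpow a (Suc i)) *v v) sums ((exp r - 1) *\<^sub>R v)"
    by (simp add: m divide_inverse del: mpow.simps fact_Suc power_Suc)
  then have "(\<Sum>i. ((1 / fact (Suc i)) *\<^sub>R mpow a (Suc i)) *v v) = (exp r - 1) *\<^sub>R v"
    by (rule sums_unique[symmetric])
  then have "(\<Sum>i. (1 / fact (Suc i)) *\<^sub>R mpow a (Suc i)) *v v = (exp r - 1) *\<^sub>R v"
    using bounded_linear.suminf[OF bl pexp_summable] by metis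
  then show ?thesis
    by (simp only: pexp_def matrix_vector_mult_add_rdistrib)
qed

lemma pexp_mat_1: "pexp p a = pexp (mat 1) a - (mat 1 - p)"
  by (simp add: pexp_def)

lemma ctranspose_pexp:
  assumes "ctranspose p = p" "ctranspose a = a"
  shows "ctranspose (pexp p a) = pexp p a"
proof -
  have "pexp p a \<in> {b. ctranspose b = b}"
    using assms by (intro pexp_in_subspace)
      (auto simp: subspace_def ctranspose_mpow simp del: mpow.simps)
  then show ?thesis
    by simp
qed

lemma projection_compression:
  fixes a :: "complex^'n^'n"
  assumes "projection p" "p ** a ** p = a"
  shows "p ** a = a" "a ** p = a"
proof -
  have pp: "p ** p = p"
    using assms by (simp add: projection_def)
  have "p ** a = p ** (p ** a ** p)"
    by (simp only: assms(2))
  also have "\<dots> = (p ** p) ** a ** p"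
    by (simp only: matrix_mul_assoc)
  finally show "p ** a = a"
    by (simp only: pp assms(2))
  have "a ** p = (p ** a ** p) ** p"
    by (simp only: assms(2))
  also have "\<dots> = p ** a ** (p ** p)"
    by (simp only: matrix_mul_assoc)
  finally show "a ** p = a"
    by (simp only: pp assms(2))
qed

lemma pexp_compression:
  fixes a :: "complex^'n^'n"
  assumes p: "projection p" and a: "p ** a ** p = a"
  shows "p ** pexp p a ** p = pexp p a"
proof -
  have "p ** mpow a (Suc i) ** p = mpow a (Suc i)" for i
  proof -
    have "p ** mpow a (Suc i) ** p = mpow a (Suc i) ** p"
      by (simp add: matrix_mul_assoc projection_compression(1)[OF p a])
    also have "\<dots> = mpow a i ** (a ** p)"
      by (simp only: mpow_Suc_right matrix_mul_assoc)
    finally show ?thesis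
      by (simp only: mpow_Suc_right projection_compression(2)[OF p a])
  qed
  then have "pexp p a \<in> {b. p ** b ** p = b}"
    using p by (intro pexp_in_subspace)
      (auto simp: subspace_def matrix_add_ldistrib matrix_mult_add_rdistrib projection_def simp del: mpow.simps)
  then show ?thesis
    by simp
qed

section \<open>Trace inequalities for the exponential\<close>

text \<open>The second basis is artificial: its weights sum to 1 for each \<open>e\<close>. It
  brings the pairing into the same double-sum shape as for two different eigenbases, so that the
  terms can be compared.\<close>

lemma inner_matrix_common_eigenbasis:
  fixes a b :: "complex^'n^'n"
  assumes B: "orthonormal_basis B UNIV" and a: "\<And>e. e \<in> B \<Longrightarrow> a *v e = \<alpha> e *\<^sub>R e"
    and b: "\<And>e. e \<in> B \<Longrightarrow> b *v e = \<beta> e *\<^sub>R e" and C: "orthonormal_basis C UNIV"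
  shows "2 * (a \<bullet> b) = (\<Sum>e\<in>B. \<Sum>c\<in>C. \<alpha> e * \<beta> e * (e \<bullet> c)\<^sup>2)"
proof -
  have "(\<Sum>c\<in>C. (e \<bullet> c)\<^sup>2) = 1" if "e \<in> B" for e
    using parseval[OF C, of e e] orthonormal_basis_inner[OF B that that] by (simp add: power2_eq_square)
  moreover have "2 * (a \<bullet> b) = (\<Sum>e\<in>B. \<alpha> e * \<beta> e)"
    unfolding inner_matrix_orthonormal_basis[OF B]
    by (intro sum.cong refl) (simp add: a b orthonormal_basis_inner[OF B])
  ultimately show ?thesis
    by (simp add: sum_distrib_left[symmetric])
qed

text \<open>
  In eigenbases \<open>e\<close>, \<open>c\<close> of \<open>a\<close>, \<open>b\<close> with eigenvalues \<open>r\<close>, \<open>s\<close>, the two sides differ by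
  a combination of the numbers \<open>exp r - exp s - exp s * (r - s)\<close>, which are non-negative,
  with weights \<open>(e \<bullet> c)\<^sup>2\<close>.
\<close>

lemma klein_inequality_mat_1:
  fixes a b :: "complex^'n^'n"
  assumes a: "ctranspose a = a" and b: "ctranspose b = b"
  shows "pexp (mat 1) b \<bullet> (a - b) \<le> pexp (mat 1) a \<bullet> mat 1 - pexp (mat 1) b \<bullet> mat 1"
proof -
  let ?E = "pexp (mat 1 :: complex^'n^'n)"
  obtain B \<alpha> where B: "orthonormal_basis B UNIV" and \<alpha>: "\<forall>e\<in>B. a *v e = \<alpha> e *\<^sub>R e"
    using self_adjoint_eigenbasis[OF a subspace_UNIV] by blast
  obtain C \<beta> where C: "orthonormal_basis C UNIV" and \<beta>: "\<forall>c\<in>C. b *v c = \<beta> c *\<^sub>R c"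
    using self_adjoint_eigenbasis[OF b subspace_UNIV] by blast
  have E\<alpha>: "?E a *v e = exp (\<alpha> e) *\<^sub>R e" if "e \<in> B" for e
    using pexp_eigenvector[of a e "\<alpha> e" "mat 1"] \<alpha> that by (simp add: algebra_simps)
  have E\<beta>: "?E b *v c = exp (\<beta> c) *\<^sub>R c" if "c \<in> C" for c
    using pexp_eigenvector[of b c "\<beta> c" "mat 1"] \<beta> that by (simp add: algebra_simps)
  have 1: "2 * (?E a \<bullet> mat 1) = (\<Sum>e\<in>B. \<Sum>c\<in>C. exp (\<alpha> e) * (e \<bullet> c)\<^sup>2)"
    using inner_matrix_eigenbases[OF B E\<alpha> C, of "mat 1" "\<lambda>_. 1"] by simp
  have 2: "2 * (?E b \<bullet> mat 1) = (\<Sum>e\<in>B. \<Sum>c\<in>C. exp (\<beta> c) * (e \<bullet> c)\<^sup>2)"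
    using inner_matrix_eigenbases[OF B _ C E\<beta>, of "mat 1" "\<lambda>_. 1"] by (simp add: inner_commute)
  have 3: "2 * (?E b \<bullet> a) = (\<Sum>e\<in>B. \<Sum>c\<in>C. \<alpha> e * exp (\<beta> c) * (e \<bullet> c)\<^sup>2)"
    using inner_matrix_eigenbases[OF B \<alpha>[rule_format] C E\<beta>] by (simp add: inner_commute)
  have 4: "2 * (?E b \<bullet> b) = (\<Sum>e\<in>B. \<Sum>c\<in>C. exp (\<beta> c) * \<beta> c * (e \<bullet> c)\<^sup>2)"
    using inner_matrix_common_eigenbasis[OF C E\<beta> \<beta>[rule_format] B]
    by (subst sum.swap) (simp add: inner_commute)
  have "0 \<le> (\<Sum>e\<in>B. \<Sum>c\<in>C. (exp (\<alpha> e) - exp (\<beta> c) - exp (\<beta> c) * (\<alpha> e - \<beta> c)) * (e \<bullet> c)\<^sup>2)"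
  proof (intro sum_nonneg mult_nonneg_nonneg zero_le_power2)
    fix e c
    have "exp (\<beta> c) * (1 + (\<alpha> e - \<beta> c)) \<le> exp (\<beta> c) * exp (\<alpha> e - \<beta> c)"
      by (intro mult_left_mono exp_ge_add_one_self) simp
    then show "0 \<le> exp (\<alpha> e) - exp (\<beta> c) - exp (\<beta> c) * (\<alpha> e - \<beta> c)"
      by (simp add: exp_diff algebra_simps)
  qed
  also have "\<dots> = 2 * (?E a \<bullet> mat 1) - 2 * (?E b \<bullet> mat 1) - (2 * (?E b \<bullet> a) - 2 * (?E b \<bullet> b))"
    unfolding 1 2 3 4 by (simp add: sum_subtractf sum.distrib algebra_simps)
  finally show ?thesis
    by (simp add: inner_diff_right)
qed

text \<open>All terms \<open>(exp r - exp s) * (r - s)\<close> with their weights are non-negative,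
  so each one vanishes: a pair of eigenvectors is orthogonal or has equal eigenvalues. Then the
  corresponding sum for \<open>(a - b) \<bullet> (a - b)\<close> vanishes too.\<close>

lemma pexp_strictly_monotone_mat_1:
  fixes a b :: "complex^'n^'n"
  assumes a: "ctranspose a = a" and b: "ctranspose b = b"
    and 0: "(pexp (mat 1) a - pexp (mat 1) b) \<bullet> (a - b) = 0"
  shows "a = b"
proof -
  let ?E = "pexp (mat 1 :: complex^'n^'n)"
  obtain B \<alpha> where B: "orthonormal_basis B UNIV" and \<alpha>: "\<forall>e\<in>B. a *v e = \<alpha> e *\<^sub>R e"
    using self_adjoint_eigenbasis[OF a subspace_UNIV] by blast
  obtain C \<beta> where C: "orthonormal_basis C UNIV" and \<beta>: "\<forall>c\<in>C. b *v c = \<beta> c *\<^sub>R c"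
    using self_adjoint_eigenbasis[OF b subspace_UNIV] by blast
  have E\<alpha>: "?E a *v e = exp (\<alpha> e) *\<^sub>R e" if "e \<in> B" for e
    using pexp_eigenvector[of a e "\<alpha> e" "mat 1"] \<alpha> that by (simp add: algebra_simps)
  have E\<beta>: "?E b *v c = exp (\<beta> c) *\<^sub>R c" if "c \<in> C" for c
    using pexp_eigenvector[of b c "\<beta> c" "mat 1"] \<beta> that by (simp add: algebra_simps)
  \<comment> \<open>The formula is used twice: with \<open>exp\<close> it evaluates the hypothesis,
    with the identity function it evaluates \<open>(a - b) \<bullet> (a - b)\<close>.\<close>
  have sum: "2 * ((a' - b') \<bullet> (a - b)) =
      (\<Sum>e\<in>B. \<Sum>c\<in>C. (f (\<alpha> e) - f (\<beta> c)) * (\<alpha> e - \<beta> c) * (e \<bullet> c)\<^sup>2)"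
    if f\<alpha>: "\<And>e. e \<in> B \<Longrightarrow> a' *v e = f (\<alpha> e) *\<^sub>R e"
      and f\<beta>: "\<And>c. c \<in> C \<Longrightarrow> b' *v c = f (\<beta> c) *\<^sub>R c" for f a' b'
  proof -
    have 1: "2 * (a' \<bullet> a) = (\<Sum>e\<in>B. \<Sum>c\<in>C. f (\<alpha> e) * \<alpha> e * (e \<bullet> c)\<^sup>2)"
      by (rule inner_matrix_common_eigenbasis[OF B f\<alpha> \<alpha>[rule_format] C])
    have 2: "2 * (a' \<bullet> b) = (\<Sum>e\<in>B. \<Sum>c\<in>C. f (\<alpha> e) * \<beta> c * (e \<bullet> c)\<^sup>2)"
      by (rule inner_matrix_eigenbases[OF B f\<alpha> C \<beta>[rule_format]])
    have 3: "2 * (b' \<bullet> a) = (\<Sum>e\<in>B. \<Sum>c\<in>C. \<alpha> e * f (\<beta> c) * (e \<bullet> c)\<^sup>2)"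
      using inner_matrix_eigenbases[OF B \<alpha>[rule_format] C f\<beta>] by (simp add: inner_commute)
    have 4: "2 * (b' \<bullet> b) = (\<Sum>e\<in>B. \<Sum>c\<in>C. f (\<beta> c) * \<beta> c * (e \<bullet> c)\<^sup>2)"
      using inner_matrix_common_eigenbasis[OF C f\<beta> \<beta>[rule_format] B]
      by (subst sum.swap) (simp add: inner_commute)
    have "2 * ((a' - b') \<bullet> (a - b)) = 2 * (a' \<bullet> a) - 2 * (a' \<bullet> b) - 2 * (b' \<bullet> a) + 2 * (b' \<bullet> b)"
      by (simp add: inner_diff_left inner_diff_right)
    then show ?thesis
      unfolding 1 2 3 4 by (simp add: sum_subtractf sum.distrib algebra_simps)
  qed
  have nonneg: "0 \<le> (exp r - exp s) * (r - s)" for r s :: real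
    by (cases "r \<le> s") (auto intro: mult_nonneg_nonneg mult_nonpos_nonpos)
  have fin: "finite B" "finite C"
    using B C by (auto simp: orthonormal_basis_def)
  have "(\<Sum>e\<in>B. \<Sum>c\<in>C. (exp (\<alpha> e) - exp (\<beta> c)) * (\<alpha> e - \<beta> c) * (e \<bullet> c)\<^sup>2) = 0"
    using sum[of "?E a" exp "?E b"] E\<alpha> E\<beta> 0 by simp
  then have "\<forall>e\<in>B. \<forall>c\<in>C. (exp (\<alpha> e) - exp (\<beta> c)) * (\<alpha> e - \<beta> c) * (e \<bullet> c)\<^sup>2 = 0"
    using fin nonneg by (simp add: sum_nonneg_eq_0_iff sum_nonneg)
  then have "\<forall>e\<in>B. \<forall>c\<in>C. (\<alpha> e - \<beta> c) * (\<alpha> e - \<beta> c) * (e \<bullet> c)\<^sup>2 = 0"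
    by auto
  then have "(\<Sum>e\<in>B. \<Sum>c\<in>C. (\<alpha> e - \<beta> c) * (\<alpha> e - \<beta> c) * (e \<bullet> c)\<^sup>2) = 0"
    by (intro sum.neutral ballI) blast
  moreover have "2 * ((a - b) \<bullet> (a - b)) =
      (\<Sum>e\<in>B. \<Sum>c\<in>C. (\<alpha> e - \<beta> c) * (\<alpha> e - \<beta> c) * (e \<bullet> c)\<^sup>2)"
    using \<alpha> \<beta> by (intro sum[of a "\<lambda>x. x" b]) auto
  ultimately have "(a - b) \<bullet> (a - b) = 0"
    by linarith
  then show ?thesis
    by simp
qed

text \<open>The exponentials differ by \<open>mat 1 - p\<close>, which is orthogonal to every matrix
  compressed by \<open>p\<close>.\<close>

lemma pexp_inner_compression:
  fixes a x :: "complex^'n^'n"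
  assumes p: "projection p" and x: "p ** x ** p = x"
  shows "pexp p a \<bullet> x = pexp (mat 1) a \<bullet> x"
proof -
  have "(mat 1 - p) \<bullet> x = (mat 1 - p) \<bullet> (p ** x)"
    by (simp add: projection_compression[OF p x])
  also have "\<dots> = (p ** (mat 1 - p)) \<bullet> x"
    using p by (simp add: inner_matrix_mult_left projection_def)
  also have "\<dots> = 0"
    using p by (simp add: matrix_mult_diff projection_def)
  finally show ?thesis
    by (simp add: pexp_mat_1[of p] inner_diff_left)
qed

lemma klein_inequality:
  fixes a b :: "complex^'n^'n"
  assumes p: "projection p" and a: "ctranspose a = a" "p ** a ** p = a"
    and b: "ctranspose b = b" "p ** b ** p = b"
  shows "pexp p b \<bullet> (a - b) \<le> pexp p a \<bullet> mat 1 - pexp p b \<bullet> mat 1"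
proof -
  have "p ** (a - b) ** p = a - b"
    using a b by (simp add: matrix_mult_diff)
  from pexp_inner_compression[OF p this] show ?thesis
    using klein_inequality_mat_1[OF a(1) b(1)] by (simp add: pexp_mat_1[of p] inner_diff_left)
qed

lemma pexp_strictly_monotone:
  fixes a b :: "complex^'n^'n"
  assumes a: "ctranspose a = a" and b: "ctranspose b = b"
    and 0: "(pexp p a - pexp p b) \<bullet> (a - b) = 0"
  shows "a = b"
  using pexp_strictly_monotone_mat_1[OF a b] 0 by (simp add: pexp_mat_1[of p])

section \<open>The exponential on the image of a projection\<close>

lemma pexp_eigenbasis:
  fixes a :: "complex^'n^'n"
  assumes p: "projection p" and a: "ctranspose a = a" "p ** a ** p = a"
  shows "\<exists>B \<alpha>. orthonormal_basis B (im p) \<and> (\<forall>e\<in>B. p *v e = e \<and> a *v e = \<alpha> e *\<^sub>R e \<and>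
      pexp p a *v e = exp (\<alpha> e) *\<^sub>R e)"
proof -
  have "a *v x \<in> im p" for x
    using im_subset_projection[OF p a(1)] a(2) by (auto simp: im_def)
  then obtain B \<alpha> where B: "orthonormal_basis B (im p)" and e: "\<forall>e\<in>B. a *v e = \<alpha> e *\<^sub>R e"
    using self_adjoint_eigenbasis[OF a(1) subspace_im[of p]] by blast
  have pe: "p *v e = e" if "e \<in> B" for e
  proof -
    have "e \<in> im p"
      using B that by (auto simp: orthonormal_basis_def intro: span_base)
    then show ?thesis
      by (simp add: im_projection[OF p])
  qed
  have "pexp p a *v e = exp (\<alpha> e) *\<^sub>R e" if "e \<in> B" for e
    using pexp_eigenvector[of a e "\<alpha> e" p] e that pe by (simp add: algebra_simps)
  then show ?thesis
    using B e pe by blast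
qed

lemma projection_basis_expansion:
  fixes p :: "complex^'n^'n"
  assumes p: "projection p" and B: "orthonormal_basis B (im p)"
  shows "p *v x = (\<Sum>e\<in>B. (x \<bullet> e) *\<^sub>R e)"
proof -
  have "p *v x = (\<Sum>e\<in>B. ((p *v x) \<bullet> e) *\<^sub>R e)"
    by (rule orthonormal_basis_expansion[OF B]) (simp add: im_def)
  also have "\<dots> = (\<Sum>e\<in>B. (x \<bullet> e) *\<^sub>R e)"
  proof (intro sum.cong refl)
    fix e assume "e \<in> B"
    then have "e \<in> im p"
      using B by (auto simp: orthonormal_basis_def intro: span_base)
    then have "p *v e = e"
      by (simp add: im_projection[OF p])
    then have "(p *v x) \<bullet> e = x \<bullet> e"
      using p inner_matrix_vector[of x p e] by (simp add: projection_def)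
    then show "((p *v x) \<bullet> e) *\<^sub>R e = (x \<bullet> e) *\<^sub>R e"
      by simp
  qed
  finally show ?thesis .
qed

lemma compressed_quadratic_form:
  fixes a :: "complex^'n^'n"
  assumes p: "projection p" and B: "orthonormal_basis B (im p)"
    and a: "p ** a ** p = a" and e: "\<And>e. e \<in> B \<Longrightarrow> a *v e = \<alpha> e *\<^sub>R e"
  shows "x \<bullet> (a *v x) = (\<Sum>e\<in>B. \<alpha> e * (x \<bullet> e)\<^sup>2)"
proof -
  have "a *v x = a *v (p *v x)"
    using projection_compression(2)[OF p a] by (simp add: matrix_vector_mul_assoc)
  also have "\<dots> = (\<Sum>e\<in>B. (x \<bullet> e) *\<^sub>R (\<alpha> e *\<^sub>R e))"
    by (simp add: projection_basis_expansion[OF p B] linear_sum[OF matrix_vector_mul_linear] e)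
  finally show ?thesis
    by (simp add: inner_sum_right power2_eq_square mult_ac)
qed

lemma psd_pexp:
  fixes a :: "complex^'n^'n"
  assumes p: "projection p" and a: "ctranspose a = a" "p ** a ** p = a"
  shows "psd (pexp p a)"
proof -
  obtain B \<alpha> where B: "orthonormal_basis B (im p)"
    and e: "\<forall>e\<in>B. p *v e = e \<and> a *v e = \<alpha> e *\<^sub>R e \<and> pexp p a *v e = exp (\<alpha> e) *\<^sub>R e"
    using pexp_eigenbasis[OF p a] by blast
  have "0 \<le> x \<bullet> (pexp p a *v x)" for x
    using compressed_quadratic_form[OF p B pexp_compression[OF p a(2)], of "\<lambda>e. exp (\<alpha> e)" x] e
    by (auto intro: sum_nonneg)
  then show ?thesis
    using p a by (simp add: psd_def projection_def ctranspose_pexp)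
qed

text \<open>On \<open>im p\<close> the exponential has only positive eigenvalues, so it vanishes
  exactly where \<open>p\<close> does. Hence a Gibbs state of the compressed algebra has full
  support \<open>p\<close>.\<close>

lemma im_pexp:
  fixes a :: "complex^'n^'n"
  assumes p: "projection p" and a: "ctranspose a = a" "p ** a ** p = a"
  shows "im (pexp p a) = im p"
proof -
  obtain B \<alpha> where B: "orthonormal_basis B (im p)"
    and e: "\<forall>e\<in>B. p *v e = e \<and> a *v e = \<alpha> e *\<^sub>R e \<and> pexp p a *v e = exp (\<alpha> e) *\<^sub>R e"
    using pexp_eigenbasis[OF p a] by blast
  have ctp: "ctranspose p = p"
    using p by (simp add: projection_def)
  have "p *v x = 0" if "pexp p a *v x = 0" for x
  proof -
    have "(\<Sum>e\<in>B. exp (\<alpha> e) * (x \<bullet> e)\<^sup>2) = 0"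
      using compressed_quadratic_form[OF p B pexp_compression[OF p a(2)], of "\<lambda>e. exp (\<alpha> e)" x] e that
      by simp
    then have "\<forall>e\<in>B. x \<bullet> e = 0"
      using B by (simp add: sum_nonneg_eq_0_iff orthonormal_basis_def)
    then show ?thesis
      by (simp add: projection_basis_expansion[OF p B])
  qed
  then have "im p \<subseteq> im (pexp p a)"
    by (subst im_subset_iff_kernel) (auto simp: ctp ctranspose_pexp a)
  moreover have "im (pexp p a) \<subseteq> im p"
    using pexp_compression[OF p a(2)] by (simp add: im_subset_projection[OF p] ctranspose_pexp ctp a)
  ultimately show ?thesis
    by blast
qed

lemma trace_pexp_pos:
  fixes a :: "complex^'n^'n"
  assumes p: "projection p" "p \<noteq> 0" and a: "ctranspose a = a" "p ** a ** p = a"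
  shows "0 < pexp p a \<bullet> mat 1"
proof -
  have "pexp p a \<noteq> 0"
  proof
    assume "pexp p a = 0"
    then have "im p = {0}"
      using im_pexp[OF p(1) a] by (auto simp: im_def)
    then have "p = 0"
      by (auto simp: matrix_eq im_def)
    with p show False
      by simp
  qed
  then show ?thesis
    using psd_trace_zero[OF psd_pexp[OF p(1) a]] psd_inner_nonneg[OF psd_pexp[OF p(1) a] psd_mat_1]
    by fastforce
qed

text \<open>An eigenbasis of \<open>im p\<close> together with the kernel of \<open>p\<close> spans
  the space and consists of eigenvectors of the scaled exponential, so
  \<open>mlog_eigenvector\<close> determines the logarithm.\<close>

lemma mlog_normalized_pexp:
  fixes a :: "complex^'n^'n"
  assumes p: "projection p" and a: "ctranspose a = a" "p ** a ** p = a" and r: "0 < r"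
  shows "mlog (r *\<^sub>R pexp p a) = a + ln r *\<^sub>R p"
proof -
  obtain B \<alpha> where B: "orthonormal_basis B (im p)"
    and e: "\<forall>e\<in>B. p *v e = e \<and> a *v e = \<alpha> e *\<^sub>R e \<and> pexp p a *v e = exp (\<alpha> e) *\<^sub>R e"
    using pexp_eigenbasis[OF p a] by blast
  let ?t = "r *\<^sub>R pexp p a"
  have t: "ctranspose ?t = ?t"
    using p a by (simp add: projection_def ctranspose_pexp)
  show ?thesis
  proof (rule matrix_eqI_span[of "B \<union> {x. p *v x = 0}"])
    show "span (B \<union> {x. p *v x = 0}) = UNIV"
    proof (intro equalityI subset_UNIV subsetI)
      fix x
      have "p *v x \<in> span B"
        using B by (simp add: orthonormal_basis_def im_def)
      then have "p *v x \<in> span (B \<union> {x. p *v x = 0})"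
        using span_mono[of B "B \<union> {x. p *v x = 0}"] by blast
      moreover have "x - p *v x \<in> span (B \<union> {x. p *v x = 0})"
        using p by (intro span_base) (simp add: algebra_simps projection_def matrix_vector_mul_assoc)
      ultimately have "p *v x + (x - p *v x) \<in> span (B \<union> {x. p *v x = 0})"
        by (rule span_add)
      then show "x \<in> span (B \<union> {x. p *v x = 0})"
        by simp
    qed
    show "mlog ?t *v x = (a + ln r *\<^sub>R p) *v x" if x: "x \<in> B \<union> {x. p *v x = 0}" for x
    proof (cases "x \<in> B")
      case True
      then have "?t *v x = (r * exp (\<alpha> x)) *\<^sub>R x"
        using e by simp
      from mlog_eigenvector[OF t this] show ?thesis
        using r e True by (simp add: ln_mult matrix_vector_mult_add_rdistrib algebra_simps)
    next
      case False
      then have px: "p *v x = 0"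
        using x by blast
      have "c *v x = 0" if "p ** c ** p = c" for c
        using px projection_compression(2)[OF p that] by (metis matrix_vector_mul_assoc matrix_vector_mult_0_right)
      \<comment> \<open>Off the support the eigenvalue is 0, and \<open>ln 0 = 0\<close> makes the
        logarithm vanish as well.\<close>
      then have "?t *v x = 0 *\<^sub>R x" "a *v x = 0"
        using a pexp_compression[OF p a(2)] by auto
      with mlog_eigenvector[OF t this(1)] px show ?thesis
        by (simp add: matrix_vector_mult_add_rdistrib)
    qed
  qed
qed

text \<open>On \<open>im p\<close>, adding a multiple of \<open>p\<close> only shifts the
  eigenvalues. This absorbs the normalising constant of a Gibbs state and, later, the centring at
  \<open>\<rho>\<close>.\<close>

lemma pexp_shift:
  fixes a :: "complex^'n^'n"
  assumes p: "projection p" and a: "ctranspose a = a" "p ** a ** p = a"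
  shows "pexp p (a + r *\<^sub>R p) = exp r *\<^sub>R pexp p a"
proof -
  obtain B \<alpha> where B: "orthonormal_basis B (im p)"
    and e: "\<forall>e\<in>B. p *v e = e \<and> a *v e = \<alpha> e *\<^sub>R e \<and> pexp p a *v e = exp (\<alpha> e) *\<^sub>R e"
    using pexp_eigenbasis[OF p a] by blast
  have c: "p ** (a + r *\<^sub>R p) ** p = a + r *\<^sub>R p"
    using a p by (simp add: matrix_add_ldistrib matrix_mult_add_rdistrib projection_def)
  have eq: "pexp p (a + r *\<^sub>R p) *v e = exp r *\<^sub>R pexp p a *v e" if "e \<in> B" for e
  proof -
    have "(a + r *\<^sub>R p) *v e = (\<alpha> e + r) *\<^sub>R e"
      using e that by (simp add: matrix_vector_mult_add_rdistrib algebra_simps)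
    from pexp_eigenvector[OF this, of p] show ?thesis
      using e that by (simp add: exp_add algebra_simps)
  qed
  have "pexp p (a + r *\<^sub>R p) *v x = (exp r *\<^sub>R pexp p a) *v x" for x
  proof -
    have "pexp p (a + r *\<^sub>R p) *v x = pexp p (a + r *\<^sub>R p) *v (p *v x)"
      using projection_compression(2)[OF p pexp_compression[OF p c]] by (simp add: matrix_vector_mul_assoc)
    also have "\<dots> = (exp r *\<^sub>R pexp p a) *v (p *v x)"
      by (simp add: projection_basis_expansion[OF p B] linear_sum[OF matrix_vector_mul_linear] eq)
    also have "\<dots> = (exp r *\<^sub>R pexp p a) *v x"
      using projection_compression(2)[OF p pexp_compression[OF p a(2)]] by (simp add: matrix_vector_mul_assoc)
    finally show ?thesis .
  qed
  then show ?thesis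
    by (simp add: matrix_eq)
qed

text \<open>The scalar bound \<open>1 + r \<le> exp r\<close> is averaged with the weights
  \<open>(x \<bullet> e)\<^sup>2\<close>, whose sum is 1. With the next lemma it yields linear
  growth of the trace, as coercivity requires.\<close>

lemma pexp_quadratic_form_ge:
  fixes a :: "complex^'n^'n"
  assumes p: "projection p" and a: "ctranspose a = a" "p ** a ** p = a"
    and x: "p *v x = x" "norm x = 1"
  shows "1 + x \<bullet> (a *v x) \<le> x \<bullet> (pexp p a *v x)"
proof -
  obtain B \<alpha> where B: "orthonormal_basis B (im p)"
    and e: "\<forall>e\<in>B. p *v e = e \<and> a *v e = \<alpha> e *\<^sub>R e \<and> pexp p a *v e = exp (\<alpha> e) *\<^sub>R e"
    using pexp_eigenbasis[OF p a] by blast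
  have pp: "p ** p ** p = p"
    using p by (simp add: projection_def)
  have 1: "1 = (\<Sum>e\<in>B. 1 * (x \<bullet> e)\<^sup>2)"
    using compressed_quadratic_form[OF p B pp, of "\<lambda>_. 1" x] e x by (simp add: norm_eq_1)
  have 2: "x \<bullet> (a *v x) = (\<Sum>e\<in>B. \<alpha> e * (x \<bullet> e)\<^sup>2)"
    using e by (intro compressed_quadratic_form[OF p B a(2)]) auto
  have 3: "x \<bullet> (pexp p a *v x) = (\<Sum>e\<in>B. exp (\<alpha> e) * (x \<bullet> e)\<^sup>2)"
    using e by (intro compressed_quadratic_form[OF p B pexp_compression[OF p a(2)]]) auto
  have "1 + x \<bullet> (a *v x) = (\<Sum>e\<in>B. (1 + \<alpha> e) * (x \<bullet> e)\<^sup>2)"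
    unfolding 2 by (subst 1) (simp add: sum.distrib algebra_simps)
  also have "\<dots> \<le> x \<bullet> (pexp p a *v x)"
    unfolding 3 by (intro sum_mono mult_right_mono exp_ge_add_one_self) simp
  finally show ?thesis .
qed

lemma psd_quadratic_form_le_trace:
  fixes a :: "complex^'n^'n"
  assumes a: "psd a" and x: "norm x = 1"
  shows "x \<bullet> (a *v x) \<le> 2 * (a \<bullet> mat 1)"
proof -
  obtain B where B: "x \<in> B" "pairwise orthogonal B" "\<And>e. e \<in> B \<Longrightarrow> norm e = 1" "independent B"
    "span B = UNIV"
    using vector_in_orthonormal_basis[OF x] by metis
  then have "orthonormal_basis B UNIV"
    by (auto simp: orthonormal_basis_def independent_imp_finite)
  from inner_matrix_orthonormal_basis[OF this, of a "mat 1"]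
  have "2 * (a \<bullet> mat 1) = (\<Sum>e\<in>B. e \<bullet> (a *v e))"
    by (simp add: inner_commute)
  moreover have "x \<bullet> (a *v x) \<le> (\<Sum>e\<in>B. e \<bullet> (a *v e))"
    using a B by (intro member_le_sum) (auto simp: psd_def independent_imp_finite)
  ultimately show ?thesis
    by simp
qed

section \<open>Gibbs states and the Pythagorean identity\<close>

lemma cstar_subalgebra_mult: "cstar_subalgebra A \<Longrightarrow> a \<in> A \<Longrightarrow> b \<in> A \<Longrightarrow> a ** b \<in> A"
  by (simp add: cstar_subalgebra_def)

lemma ctranspose_compression:
  assumes "projection p" "ctranspose a = a"
  shows "ctranspose (p ** a ** p) = p ** a ** p"
  using assms by (simp add: ctranspose_mult projection_def matrix_mul_assoc)

lemma compression_idem: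
  assumes "projection p"
  shows "p ** (p ** a ** p) ** p = p ** a ** p"
proof -
  have "p ** (p ** a ** p) ** p = (p ** p) ** a ** (p ** p)"
    by (simp only: matrix_mul_assoc)
  then show ?thesis
    using assms by (simp add: projection_def)
qed

lemma inner_compression:
  fixes a b :: "complex^'n^'n"
  assumes "projection p"
  shows "(p ** a ** p) \<bullet> b = a \<bullet> (p ** b ** p)"
proof -
  have ct: "ctranspose p = p"
    using assms by (simp add: projection_def)
  have "(p ** a ** p) \<bullet> b = (p ** a) \<bullet> (b ** p)"
    by (subst inner_matrix_mult_right) (simp only: ct)
  also have "\<dots> = a \<bullet> (p ** (b ** p))"
    by (subst inner_matrix_mult_left) (simp only: ct)
  finally show ?thesis
    by (simp only: matrix_mul_assoc)
qed

lemma mem_compress_iff: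
  assumes A: "cstar_subalgebra A" and p: "p \<in> A" "projection p"
  shows "a \<in> compress p A \<longleftrightarrow> a \<in> A \<and> p ** a ** p = a"
  using cstar_subalgebra_mult[OF A] p compression_idem[OF p(2)] unfolding compress_def
  by (metis (no_types, lifting) imageE image_eqI)

lemma mem_states_iff: "\<rho> \<in> states A \<longleftrightarrow> \<rho> \<in> A \<and> psd \<rho> \<and> \<rho> \<bullet> mat 1 = 1"
  unfolding states_def using trace_self_adjoint[of \<rho>] by (auto simp: psd_def)

lemma mem_states_compress_iff:
  assumes A: "cstar_subalgebra A" and p: "p \<in> A" "projection p"
  shows "\<rho> \<in> states (compress p A) \<longleftrightarrow> \<rho> \<in> states A \<and> p ** \<rho> ** p = \<rho>"
  using mem_compress_iff[OF A p] by (auto simp: states_def)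

lemma ctranspose_state: "\<rho> \<in> states A \<Longrightarrow> ctranspose \<rho> = \<rho>"
  by (simp add: states_def psd_def)

lemma im_state_subset_iff:
  assumes A: "cstar_subalgebra A" and p: "p \<in> A" "projection p" and \<rho>: "\<rho> \<in> states A"
  shows "im \<rho> \<subseteq> im p \<longleftrightarrow> \<rho> \<in> states (compress p A)"
  using mem_states_compress_iff[OF A p] im_subset_projection[OF p(2) ctranspose_state[OF \<rho>]] \<rho> by simp

lemma state_inner_projection:
  assumes A: "cstar_subalgebra A" and p: "p \<in> A" "projection p" and \<rho>: "\<rho> \<in> states (compress p A)"
  shows "\<rho> \<bullet> p = 1"
proof -
  have "\<rho> \<bullet> p = \<rho> \<bullet> (p ** mat 1 ** p)"
    using p by (simp add: projection_def)
  also have "\<dots> = (p ** \<rho> ** p) \<bullet> mat 1"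
    by (rule inner_compression[OF p(2), symmetric])
  finally show ?thesis
    using \<rho> mem_states_compress_iff[OF A p] by (simp add: mem_states_iff)
qed

lemma state_inner_compression:
  assumes A: "cstar_subalgebra A" and p: "p \<in> A" "projection p" and \<rho>: "\<rho> \<in> states (compress p A)"
  shows "\<rho> \<bullet> (p ** a ** p) = \<rho> \<bullet> a"
  using inner_compression[OF p(2), of \<rho> a] \<rho> mem_states_compress_iff[OF A p] by simp

locale gibbs_data =
  fixes A :: "(complex^'n^'n) set" and p h :: "complex^'n^'n"
  assumes A: "cstar_subalgebra A" and pA: "p \<in> A" and p: "projection p" and p0: "p \<noteq> 0"
    and hA: "h \<in> A" and h: "ctranspose h = h" and php: "p ** h ** p = h"
begin

lemma gibbs_eq: "gibbs (compress p A) h = (1 / (pexp p h \<bullet> mat 1)) *\<^sub>R pexp p h"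
proof -
  have "alg_exp (compress p A) h = pexp p h"
    using alg_one_compress[OF _ pA] p by (simp add: alg_exp_eq_pexp projection_def)
  moreover have "trace (pexp p h) = complex_of_real (pexp p h \<bullet> mat 1)"
    using p h by (intro trace_self_adjoint ctranspose_pexp) (auto simp: projection_def)
  ultimately show ?thesis
    by (simp add: gibbs_def flip: cscale_of_real)
qed

text \<open>The normalisation is moved into the exponent as a multiple of \<open>p\<close>. Having
  the state as the exponential of its own logarithm makes strict monotonicity applicable without a
  scalar factor.\<close>

lemma gibbs_eq_pexp_mlog:
  "mlog (gibbs (compress p A) h) = h - ln (pexp p h \<bullet> mat 1) *\<^sub>R p"
  "gibbs (compress p A) h = pexp p (mlog (gibbs (compress p A) h))"
proof -
  define z where "z = pexp p h \<bullet> mat 1"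
  have z: "0 < z"
    using trace_pexp_pos[OF p p0 h php] by (simp add: z_def)
  have *: "mlog (gibbs (compress p A) h) = h + (- ln z) *\<^sub>R p"
    using mlog_normalized_pexp[OF p h php, of "1 / z"] z by (simp add: gibbs_eq z_def[symmetric] ln_div)
  then show "mlog (gibbs (compress p A) h) = h - ln (pexp p h \<bullet> mat 1) *\<^sub>R p"
    by (simp add: z_def)
  show "gibbs (compress p A) h = pexp p (mlog (gibbs (compress p A) h))"
    unfolding * pexp_shift[OF p h php] using z
    by (simp add: gibbs_eq z_def[symmetric] exp_minus divide_inverse)
qed

lemma im_gibbs: "im (gibbs (compress p A) h) = im p"
proof -
  have "ctranspose (mlog (gibbs (compress p A) h)) = mlog (gibbs (compress p A) h)"
    using p h by (simp add: gibbs_eq_pexp_mlog(1) projection_def)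
  moreover have "p ** mlog (gibbs (compress p A) h) ** p = mlog (gibbs (compress p A) h)"
    using p php by (simp add: gibbs_eq_pexp_mlog(1) projection_def matrix_mult_diff)
  ultimately show ?thesis
    using im_pexp[OF p] gibbs_eq_pexp_mlog(2) by metis
qed

lemma gibbs_state: "gibbs (compress p A) h \<in> states (compress p A)"
proof -
  define z where "z = pexp p h \<bullet> mat 1"
  have z: "0 < z"
    using trace_pexp_pos[OF p p0 h php] by (simp add: z_def)
  have mpow: "mpow h (Suc i) \<in> A" for i
    using hA by (induction i) (auto intro: cstar_subalgebra_mult[OF A])
  have "pexp p h \<in> A"
    by (rule pexp_in_subspace[OF subspace_cstar_subalgebra[OF A] pA mpow])
  then have "gibbs (compress p A) h \<in> A"
    by (simp add: gibbs_eq subspace_scale[OF subspace_cstar_subalgebra[OF A]])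
  moreover have "psd (gibbs (compress p A) h)"
    using psd_pexp[OF p h php] z by (simp add: gibbs_eq psd_def z_def[symmetric])
  moreover have "gibbs (compress p A) h \<bullet> mat 1 = 1"
    using z by (simp add: gibbs_eq z_def)
  moreover have "p ** gibbs (compress p A) h ** p = gibbs (compress p A) h"
    by (simp add: gibbs_eq pexp_compression[OF p php])
  ultimately show ?thesis
    by (simp only: mem_states_compress_iff[OF A pA p] mem_states_iff[of _ A] simp_thms)
qed

end

lemma gibbs_data_compression:
  assumes A: "cstar_subalgebra A" and p: "p \<in> A" "projection p" "p \<noteq> 0" and s: "s \<in> self_adjoint A"
  shows "gibbs_data A p (p ** s ** p)"
proof
  have "s \<in> A" "ctranspose s = s"
    using s by (auto simp: self_adjoint_def)
  then show "p ** s ** p \<in> A" "ctranspose (p ** s ** p) = p ** s ** p"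
    using p ctranspose_compression by (simp_all add: cstar_subalgebra_mult[OF A])
qed (fact A p compression_idem[OF p(2)])+

section \<open>Mean values and the projection lattice\<close>

lemma orth_proj:
  assumes U: "subspace U"
  shows "orth_proj U a \<in> U" and "w \<in> U \<Longrightarrow> (a - orth_proj U a) \<bullet> w = 0"
proof -
  obtain y z where yz: "y \<in> U" "\<And>w. w \<in> U \<Longrightarrow> orthogonal z w" "a = y + z"
    using orthogonal_subspace_decomp_exists[of U a] span_eq_iff[THEN iffD2, OF U] by metis
  have "y' = y" if y': "y' \<in> U" "\<forall>w\<in>U. orthogonal (a - y') w" for y'
  proof -
    have d: "y' - y \<in> U"
      using y'(1) yz(1) by (rule subspace_diff[OF U])
    have "(y' - y) \<bullet> (y' - y) = z \<bullet> (y' - y) - (a - y') \<bullet> (y' - y)"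
      using yz(3) by (simp add: inner_diff_left inner_add_left)
    also have "\<dots> = 0"
      using yz(2)[OF d] y'(2) d by (simp add: orthogonal_def)
    finally show ?thesis
      by simp
  qed
  then have ex: "\<exists>!y. y \<in> U \<and> (\<forall>w\<in>U. orthogonal (a - y) w)"
    using yz by (intro ex1I[of _ y]) auto
  from theI'[OF ex] show "orth_proj U a \<in> U" "w \<in> U \<Longrightarrow> (a - orth_proj U a) \<bullet> w = 0"
    by (auto simp: orth_proj_def orthogonal_def)
qed

lemma orth_proj_unique:
  assumes U: "subspace U" and y: "y \<in> U" "\<And>w. w \<in> U \<Longrightarrow> (a - y) \<bullet> w = 0"
  shows "orth_proj U a = y"
proof -
  have d: "orth_proj U a - y \<in> U"
    using orth_proj(1)[OF U] y(1) by (rule subspace_diff[OF U])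
  have "(orth_proj U a - y) \<bullet> (orth_proj U a - y) =
      (a - y) \<bullet> (orth_proj U a - y) - (a - orth_proj U a) \<bullet> (orth_proj U a - y)"
    by (simp add: inner_diff_left)
  then show ?thesis
    using orth_proj(2)[OF U d] y(2)[OF d] by simp
qed

lemma inner_orth_proj:
  assumes U: "subspace U" and w: "w \<in> U"
  shows "orth_proj U a \<bullet> w = a \<bullet> w"
  using orth_proj(2)[OF U w, of a] by (simp add: inner_diff_left)

lemma orth_proj_eq_iff:
  assumes U: "subspace U"
  shows "orth_proj U a = orth_proj U b \<longleftrightarrow> (\<forall>w\<in>U. a \<bullet> w = b \<bullet> w)"
proof
  assume "orth_proj U a = orth_proj U b"
  then show "\<forall>w\<in>U. a \<bullet> w = b \<bullet> w"
    using inner_orth_proj[OF U] by metis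
next
  assume "\<forall>w\<in>U. a \<bullet> w = b \<bullet> w"
  then show "orth_proj U a = orth_proj U b"
    by (intro orth_proj_unique[OF U orth_proj(1)[OF U]]) (simp add: inner_diff_left inner_orth_proj[OF U])
qed

lemma linear_orth_proj:
  assumes U: "subspace U"
  shows "linear (orth_proj U)"
proof (rule linearI)
  show "orth_proj U (a + b) = orth_proj U a + orth_proj U b" for a b
    by (rule orth_proj_unique[OF U])
       (simp_all add: inner_diff_left inner_add_left inner_orth_proj[OF U] subspace_add[OF U] orth_proj(1)[OF U])
  show "orth_proj U (r *\<^sub>R a) = r *\<^sub>R orth_proj U a" for r a
    by (rule orth_proj_unique[OF U])
       (simp_all add: inner_diff_left inner_orth_proj[OF U] subspace_scale[OF U] orth_proj(1)[OF U])
qed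

text \<open>The decomposition of \<open>a\<close> along \<open>U\<close> and its complement is
  unique, so the sum of sets in \<open>proj_lattice\<close> is a preimage under
  \<open>orth_proj\<close>. All later arguments use that form.\<close>

lemma mem_face_plus_perp_iff:
  assumes A: "cstar_subalgebra A" and U: "subspace U" "U \<subseteq> self_adjoint A" and F: "F \<subseteq> U"
    and a: "a \<in> self_adjoint A"
  shows "a \<in> {f + v | f v. f \<in> F \<and> v \<in> perp A U} \<longleftrightarrow> orth_proj U a \<in> F"
proof
  assume "a \<in> {f + v | f v. f \<in> F \<and> v \<in> perp A U}"
  then obtain f v where f: "f \<in> F" and v: "v \<in> perp A U" and a: "a = f + v"
    by blast
  have "orth_proj U a = f"
    using f v F by (intro orth_proj_unique[OF U(1)]) (auto simp: a perp_def orthogonal_def)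
  with f show "orth_proj U a \<in> F"
    by simp
next
  assume F: "orth_proj U a \<in> F"
  have "orth_proj U a \<in> self_adjoint A"
    using orth_proj(1)[OF U(1)] U(2) by blast
  then have "a - orth_proj U a \<in> self_adjoint A"
    using a subspace_diff[OF subspace_cstar_subalgebra[OF A]] by (simp add: self_adjoint_def)
  then have "a - orth_proj U a \<in> perp A U"
    using orth_proj(2)[OF U(1)] by (simp add: perp_def orthogonal_def)
  with F show "a \<in> {f + v | f v. f \<in> F \<and> v \<in> perp A U}"
    by (intro CollectI exI[of _ "orth_proj U a"] exI[of _ "a - orth_proj U a"]) simp
qed

lemma states_subset_self_adjoint: "states A \<subseteq> self_adjoint A"
  by (auto simp: states_def psd_def self_adjoint_def)

lemma mean_value_set_subset: "subspace U \<Longrightarrow> mean_value_set A U \<subseteq> U"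
  using orth_proj(1) by (auto simp: mean_value_set_def)

lemma mem_proj_lattice_iff:
  fixes A :: "(complex^'n^'n) set"
  assumes A: "cstar_subalgebra A" and U: "subspace U" "U \<subseteq> self_adjoint A"
  shows "p \<in> proj_lattice A U \<longleftrightarrow> p \<in> A \<and> projection p \<and>
    (\<exists>F. F face_of mean_value_set A U \<and> states (compress p A) = {\<tau> \<in> states A. orth_proj U \<tau> \<in> F})"
proof -
  have *: "states A \<inter> {f + v | f v. f \<in> F \<and> v \<in> perp A U} = {\<tau> \<in> states A. orth_proj U \<tau> \<in> F}"
    if "F face_of mean_value_set A U" for F
  proof -
    have "F \<subseteq> U"
      using face_of_imp_subset[OF that] mean_value_set_subset[OF U(1)] by blast
    have inter: "S \<inter> X = {x \<in> S. P x}" if "\<And>x. x \<in> S \<Longrightarrow> x \<in> X \<longleftrightarrow> P x" for S X :: "(complex^'n^'n) set" and P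
      using that by blast
    show ?thesis
      by (rule inter, rule mem_face_plus_perp_iff[OF A U \<open>F \<subseteq> U\<close>])
         (rule states_subset_self_adjoint[THEN subsetD])
  qed
  show ?thesis
    unfolding proj_lattice_def mem_Collect_eq using *
    by (intro conj_cong ex_cong1 refl) simp_all
qed

lemma proj_lattice_states_cong:
  assumes A: "cstar_subalgebra A" and U: "subspace U" "U \<subseteq> self_adjoint A"
    and p: "p \<in> proj_lattice A U" and \<rho>: "\<rho> \<in> states A" and \<tau>: "\<tau> \<in> states (compress p A)"
    and eq: "orth_proj U \<rho> = orth_proj U \<tau>"
  shows "\<rho> \<in> states (compress p A)"
proof -
  obtain F where "states (compress p A) = {\<tau> \<in> states A. orth_proj U \<tau> \<in> F}"
    using p unfolding mem_proj_lattice_iff[OF A U] by (elim conjE exE)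
  note F = this
  have "orth_proj U \<tau> \<in> F"
    using \<tau> by (simp add: F)
  then show ?thesis
    using \<rho> eq by (simp add: F)
qed

text \<open>
  The two Gibbs states \<open>\<sigma>\<close>, \<open>\<tau>\<close> have the same support, and \<open>(\<sigma> - \<tau>) \<bullet> (mlog \<sigma> - mlog \<tau>)\<close>
  vanishes since the difference of the logarithms lies in \<open>p U p + \<real> p\<close>.
\<close>

lemma gibbs_mean_value_inj:
  fixes A :: "(complex^'n^'n) set"
  assumes A: "cstar_subalgebra A" and U: "subspace U" "U \<subseteq> self_adjoint A"
    and p: "p \<in> proj_lattice A U" "p \<noteq> 0" and q: "q \<in> proj_lattice A U" "q \<noteq> 0"
    and s: "s \<in> self_adjoint A" and t: "t \<in> self_adjoint A" and st: "s - t \<in> U"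
    and eq: "orth_proj U (gibbs (compress p A) (p ** s ** p)) = orth_proj U (gibbs (compress q A) (q ** t ** q))"
  shows "gibbs (compress p A) (p ** s ** p) = gibbs (compress q A) (q ** t ** q)"
proof -
  define \<sigma> \<tau> where "\<sigma> = gibbs (compress p A) (p ** s ** p)" and "\<tau> = gibbs (compress q A) (q ** t ** q)"
  have pA: "p \<in> A" "projection p" and qA: "q \<in> A" "projection q"
    using p q by (auto simp: proj_lattice_def)
  have gp: "gibbs_data A p (p ** s ** p)"
    using gibbs_data_compression[OF A pA p(2) s] .
  have gq: "gibbs_data A q (q ** t ** q)"
    using gibbs_data_compression[OF A qA q(2) t] .
  have \<sigma>p: "\<sigma> \<in> states (compress p A)" and \<tau>q: "\<tau> \<in> states (compress q A)"
    unfolding \<sigma>_def \<tau>_def using gibbs_data.gibbs_state[OF gp] gibbs_data.gibbs_state[OF gq] by auto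
  have \<sigma>A: "\<sigma> \<in> states A" and \<tau>A: "\<tau> \<in> states A"
    using \<sigma>p \<tau>q mem_states_compress_iff[OF A pA] mem_states_compress_iff[OF A qA] by auto
  have \<tau>p: "\<tau> \<in> states (compress p A)" and \<sigma>q: "\<sigma> \<in> states (compress q A)"
    using proj_lattice_states_cong[OF A U p(1) \<tau>A \<sigma>p] proj_lattice_states_cong[OF A U q(1) \<sigma>A \<tau>q] eq
    unfolding \<sigma>_def[symmetric] \<tau>_def[symmetric] by simp_all
  \<comment> \<open>By equality of the mean values each state lies in the other's compressed
    algebra; as \<open>p\<close> and \<open>q\<close> are their full supports, this forces both
    inclusions.\<close>
  have "im q \<subseteq> im p" "im p \<subseteq> im q"
    using im_state_subset_iff[OF A pA \<tau>A] \<tau>p im_state_subset_iff[OF A qA \<sigma>A] \<sigma>q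
      gibbs_data.im_gibbs[OF gp] gibbs_data.im_gibbs[OF gq]
    unfolding \<sigma>_def[symmetric] \<tau>_def[symmetric] by simp_all
  then have qp: "q = p"
    using projection_eqI[OF qA(2) pA(2)] by blast
  obtain c where c: "mlog \<sigma> = p ** s ** p - c *\<^sub>R p"
    using gibbs_data.gibbs_eq_pexp_mlog(1)[OF gp, folded \<sigma>_def] by (rule that)
  obtain d where d: "mlog \<tau> = p ** t ** p - d *\<^sub>R p"
    using gibbs_data.gibbs_eq_pexp_mlog(1)[OF gq, folded \<tau>_def, unfolded qp] by (rule that)
  have e: "\<sigma> = pexp p (mlog \<sigma>)" "\<tau> = pexp p (mlog \<tau>)"
    by (rule gibbs_data.gibbs_eq_pexp_mlog(2)[OF gp, folded \<sigma>_def],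
        rule gibbs_data.gibbs_eq_pexp_mlog(2)[OF gq, folded \<tau>_def, unfolded qp])
  \<comment> \<open>The term \<open>c - d\<close> times \<open>p\<close> pairs to the same number
    with every state of \<open>p A p\<close>, because such a state pairs to 1 with \<open>p\<close>;
    it cancels in the difference of the two states.\<close>
  have inner: "x \<bullet> (mlog \<sigma> - mlog \<tau>) = x \<bullet> (s - t) - c + d" if "x \<in> states (compress p A)" for x
    using that state_inner_compression[OF A pA that] state_inner_projection[OF A pA that]
    by (simp add: c d inner_diff_right)
  have "\<sigma> \<bullet> (s - t) = \<tau> \<bullet> (s - t)"
    using eq st unfolding \<sigma>_def[symmetric] \<tau>_def[symmetric] orth_proj_eq_iff[OF U(1)] by blast
  then have "(\<sigma> - \<tau>) \<bullet> (mlog \<sigma> - mlog \<tau>) = 0"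
    using inner[OF \<sigma>p] inner[OF \<tau>p] by (simp add: inner_diff_left)
  then have 0: "(pexp p (mlog \<sigma>) - pexp p (mlog \<tau>)) \<bullet> (mlog \<sigma> - mlog \<tau>) = 0"
    by (simp only: e[symmetric])
  have "ctranspose (mlog \<sigma>) = mlog \<sigma>" "ctranspose (mlog \<tau>) = mlog \<tau>"
    unfolding c d using pA(2) ctranspose_compression[OF pA(2), of s] ctranspose_compression[OF pA(2), of t] s t
    by (simp_all add: self_adjoint_def projection_def)
  from pexp_strictly_monotone[OF this 0] have "mlog \<sigma> = mlog \<tau>" .
  then have "pexp p (mlog \<sigma>) = pexp p (mlog \<tau>)"
    by (rule arg_cong)
  then show ?thesis
    by (simp only: e[symmetric] \<sigma>_def[symmetric] \<tau>_def[symmetric])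
qed

lemma rel_entropy_eq:
  fixes \<rho> \<sigma> :: "complex^'n^'n"
  assumes "\<rho> \<in> states A"
  shows "rel_entropy \<rho> \<sigma> = (if im \<rho> \<subseteq> im \<sigma> then ereal (\<rho> \<bullet> mlog \<rho> - \<rho> \<bullet> mlog \<sigma>) else \<infinity>)"
  using ctranspose_state[OF assms]
  by (simp add: rel_entropy_def inner_matrix_eq_Re_trace matrix_mult_diff trace_sub)

lemma pythagoras:
  fixes A :: "(complex^'n^'n) set"
  assumes A: "cstar_subalgebra A" and U: "subspace U" "U \<subseteq> self_adjoint A"
    and p: "p \<in> proj_lattice A U" "p \<noteq> 0" and q: "q \<in> proj_lattice A U" "q \<noteq> 0"
    and s: "s \<in> self_adjoint A" and t: "t \<in> self_adjoint A" and st: "s - t \<in> U"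
    and \<rho>: "\<rho> \<in> states A" and \<sigma>: "\<sigma> = gibbs (compress p A) (p ** s ** p)"
    and \<tau>: "\<tau> = gibbs (compress q A) (q ** t ** q)" and eq: "orth_proj U \<tau> = orth_proj U \<rho>"
  shows "rel_entropy \<rho> \<tau> + rel_entropy \<tau> \<sigma> = rel_entropy \<rho> \<sigma>"
proof -
  have pA: "p \<in> A" "projection p" and qA: "q \<in> A" "projection q"
    using p q by (auto simp: proj_lattice_def)
  have gp: "gibbs_data A p (p ** s ** p)"
    using gibbs_data_compression[OF A pA p(2) s] .
  have gq: "gibbs_data A q (q ** t ** q)"
    using gibbs_data_compression[OF A qA q(2) t] .
  have \<tau>q: "\<tau> \<in> states (compress q A)"
    unfolding \<tau> using gibbs_data.gibbs_state[OF gq] .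
  then have \<tau>A: "\<tau> \<in> states A"
    using mem_states_compress_iff[OF A qA] by auto
  have \<rho>q: "\<rho> \<in> states (compress q A)"
    using proj_lattice_states_cong[OF A U q(1) \<rho> \<tau>q] eq by simp
  have im\<sigma>: "im \<sigma> = im p" and im\<tau>: "im \<tau> = im q"
    using gibbs_data.im_gibbs[OF gp] gibbs_data.im_gibbs[OF gq] by (simp_all add: \<sigma> \<tau>)
  have \<rho>\<tau>: "im \<rho> \<subseteq> im \<tau>"
    using im_state_subset_iff[OF A qA \<rho>] \<rho>q im\<tau> by simp
  \<comment> \<open>The relative entropies of \<open>\<rho>\<close> and of \<open>\<tau>\<close>
    with respect to \<open>\<sigma>\<close> are thus finite or infinite together, while that of
    \<open>\<rho>\<close> with respect to \<open>\<tau>\<close> is always finite.\<close>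
  have "\<rho> \<in> states (compress p A) \<longleftrightarrow> \<tau> \<in> states (compress p A)"
    using proj_lattice_states_cong[OF A U p(1)] \<rho> \<tau>A eq by metis
  then have im: "im \<rho> \<subseteq> im \<sigma> \<longleftrightarrow> \<tau> \<in> states (compress p A)" "im \<tau> \<subseteq> im \<sigma> \<longleftrightarrow> \<tau> \<in> states (compress p A)"
    using im_state_subset_iff[OF A pA] \<rho> \<tau>A im\<sigma> by auto
  show ?thesis
  proof (cases "\<tau> \<in> states (compress p A)")
    case False
    then show ?thesis
      using \<rho>\<tau> im by (simp add: rel_entropy_eq[OF \<rho>] rel_entropy_eq[OF \<tau>A])
  next
    case True
    then have \<rho>p: "\<rho> \<in> states (compress p A)"
      using im im_state_subset_iff[OF A pA \<rho>] im\<sigma> by simp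
    obtain c where c: "mlog \<sigma> = p ** s ** p - c *\<^sub>R p"
      using gibbs_data.gibbs_eq_pexp_mlog(1)[OF gp, folded \<sigma>] by (rule that)
    obtain d where d: "mlog \<tau> = q ** t ** q - d *\<^sub>R q"
      using gibbs_data.gibbs_eq_pexp_mlog(1)[OF gq, folded \<tau>] by (rule that)
    have 1: "x \<bullet> mlog \<sigma> = x \<bullet> s - c" if "x \<in> states (compress p A)" for x
      using that state_inner_compression[OF A pA that] state_inner_projection[OF A pA that]
      by (simp add: c inner_diff_right)
    have 2: "x \<bullet> mlog \<tau> = x \<bullet> t - d" if "x \<in> states (compress q A)" for x
      using that state_inner_compression[OF A qA that] state_inner_projection[OF A qA that]
      by (simp add: d inner_diff_right)
    have "\<tau> \<bullet> (s - t) = \<rho> \<bullet> (s - t)"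
      using eq st orth_proj_eq_iff[OF U(1)] by simp
    then show ?thesis
      using \<rho>\<tau> im True 1[OF True] 1[OF \<rho>p] 2[OF \<tau>q] 2[OF \<rho>q]
      by (simp add: rel_entropy_eq[OF \<rho>] rel_entropy_eq[OF \<tau>A] inner_diff_right)
  qed
qed

section \<open>Faces of the mean value set\<close>

lemma face_of_extension:
  fixes m :: "'a::real_vector"
  assumes M: "convex M"
  shows "{y \<in> M. \<exists>\<epsilon>>0. m + \<epsilon> *\<^sub>R (m - y) \<in> M} face_of M" (is "?F face_of M")
proof -
  have shrink: "m + \<delta> *\<^sub>R (m - y) \<in> M" if y: "y \<in> M" "m + \<epsilon> *\<^sub>R (m - y) \<in> M" and \<delta>: "0 < \<delta>" "\<delta> \<le> \<epsilon>"
    for y \<delta> \<epsilon>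
  proof -
    \<comment> \<open>This weight gives \<open>m\<close> the coefficient
      \<open>1 + \<delta>\<close>, so the shorter prolongation is a convex combination of
      \<open>y\<close> and the longer one.\<close>
    define t where "t = (\<epsilon> - \<delta>) / (1 + \<epsilon>)"
    have t: "0 \<le> t" "0 \<le> 1 - t" and t': "(1 - t) * (1 + \<epsilon>) = 1 + \<delta>"
      using \<delta> by (auto simp: t_def field_simps)
    have "t *\<^sub>R y + (1 - t) *\<^sub>R (m + \<epsilon> *\<^sub>R (m - y)) \<in> M"
      using t by (intro convexD[OF M y]) auto
    also have "t *\<^sub>R y + (1 - t) *\<^sub>R (m + \<epsilon> *\<^sub>R (m - y)) =
        ((1 - t) * (1 + \<epsilon>)) *\<^sub>R m + (1 - (1 - t) * (1 + \<epsilon>)) *\<^sub>R y"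
      by (simp add: algebra_simps)
    finally show ?thesis
      unfolding t' by (simp add: algebra_simps)
  qed
  have "convex ?F"
  proof (rule convexI)
    fix x y and u v :: real
    assume x: "x \<in> ?F" and y: "y \<in> ?F" and uv: "0 \<le> u" "0 \<le> v" "u + v = 1"
    obtain \<delta> \<epsilon> where \<delta>: "\<delta> > 0" "m + \<delta> *\<^sub>R (m - x) \<in> M" and \<epsilon>: "\<epsilon> > 0" "m + \<epsilon> *\<^sub>R (m - y) \<in> M"
      using x y by blast
    define \<eta> where "\<eta> = min \<delta> \<epsilon>"
    have \<eta>: "\<eta> > 0" "\<eta> \<le> \<delta>" "\<eta> \<le> \<epsilon>"
      using \<delta> \<epsilon> by (auto simp: \<eta>_def)
    have xy: "x \<in> M" "y \<in> M"
      using x y by auto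
    have "u *\<^sub>R (m + \<eta> *\<^sub>R (m - x)) + v *\<^sub>R (m + \<eta> *\<^sub>R (m - y)) \<in> M"
      by (rule convexD[OF M shrink[OF xy(1) \<delta>(2) \<eta>(1,2)] shrink[OF xy(2) \<epsilon>(2) \<eta>(1,3)] uv])
    also have "u *\<^sub>R (m + \<eta> *\<^sub>R (m - x)) + v *\<^sub>R (m + \<eta> *\<^sub>R (m - y)) =
        (u + v) *\<^sub>R m + \<eta> *\<^sub>R ((u + v) *\<^sub>R m - (u *\<^sub>R x + v *\<^sub>R y))"
      by (simp add: algebra_simps)
    finally have "m + \<eta> *\<^sub>R (m - (u *\<^sub>R x + v *\<^sub>R y)) \<in> M"
      using uv by simp
    moreover have "u *\<^sub>R x + v *\<^sub>R y \<in> M"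
      by (rule convexD[OF M xy uv])
    ultimately show "u *\<^sub>R x + v *\<^sub>R y \<in> ?F"
      using \<eta> by blast
  qed
  moreover have ext: "a \<in> ?F"
    if a: "a \<in> M" and b: "b \<in> M" and x: "(1 - t) *\<^sub>R a + t *\<^sub>R b \<in> ?F" and t: "0 < t" "t < 1" for a b t
  proof -
    obtain \<epsilon> where \<epsilon>: "\<epsilon> > 0" and z: "m + \<epsilon> *\<^sub>R (m - ((1 - t) *\<^sub>R a + t *\<^sub>R b)) \<in> M" (is "?z \<in> M")
      using x by blast
    \<comment> \<open>Mixing the prolonged point with \<open>b\<close> in the weights
      \<open>s\<close> and \<open>s * (\<epsilon> * t)\<close> cancels \<open>b\<close> and leaves a
      prolongation from \<open>a\<close> beyond \<open>m\<close>.\<close>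
    define s where "s = 1 / (1 + \<epsilon> * t)"
    have pos: "1 + \<epsilon> * t > 0"
      using \<epsilon> t by (simp add: add_pos_pos)
    then have s: "0 < s" "s * (1 + \<epsilon> * t) = 1"
      by (auto simp: s_def)
    have "s *\<^sub>R ?z + (s * (\<epsilon> * t)) *\<^sub>R b \<in> M"
      using s \<epsilon> t by (intro convexD[OF M z b]) (auto simp: algebra_simps)
    also have "s *\<^sub>R ?z + (s * (\<epsilon> * t)) *\<^sub>R b =
        (s * (1 + \<epsilon> * t)) *\<^sub>R m + (s * \<epsilon> * (1 - t)) *\<^sub>R (m - a)"
      by (simp add: algebra_simps)
    finally have "m + (s * \<epsilon> * (1 - t)) *\<^sub>R (m - a) \<in> M"
      using s by simp
    moreover have "s * \<epsilon> * (1 - t) > 0"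
      using s \<epsilon> t by simp
    ultimately show ?thesis
      using a by blast
  qed
  moreover have "a \<in> ?F \<and> b \<in> ?F" if ab: "a \<in> M" "b \<in> M" and x: "x \<in> ?F" "x \<in> open_segment a b" for a b x
  proof -
    obtain t where t: "0 < t" "t < 1" "x = (1 - t) *\<^sub>R a + t *\<^sub>R b"
      using x(2) by (auto simp: in_segment)
    then have "x = (1 - (1 - t)) *\<^sub>R b + (1 - t) *\<^sub>R a"
      by simp
    then have "b \<in> ?F"
      using ext[OF ab(2,1), of "1 - t"] t(1,2) x(1) by simp
    moreover have "a \<in> ?F"
      using ext[OF ab, of t] t x(1) by simp
    ultimately show ?thesis
      by (intro conjI)
  qed
  ultimately show ?thesis
    unfolding face_of_def by blast
qed

text \<open>By compactness the form of \<open>a\<close> has a positive lower bound on the unit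
  sphere of \<open>im a\<close>, and on the complement both matrices vanish.\<close>

lemma psd_dominates:
  fixes a b :: "complex^'n^'n"
  assumes a: "psd a" and b: "psd b" and im: "im b \<subseteq> im a"
  shows "\<exists>\<epsilon>>0. \<epsilon> < 1 \<and> psd (a - \<epsilon> *\<^sub>R b)"
proof -
  let ?K = "sphere 0 1 \<inter> im a"
  have cta: "ctranspose a = a" and ctb: "ctranspose b = b"
    using a b by (auto simp: psd_def)
  have "compact ?K"
    by (simp add: closed_subspace compact_Int_closed subspace_im)
  have "\<exists>\<mu>>0. \<forall>y\<in>?K. \<mu> \<le> y \<bullet> (a *v y)"
  proof (cases "?K = {}")
    case True
    then show ?thesis
      by (intro exI[of _ 1]) simp
  next
    case False
    have "continuous_on ?K (\<lambda>y. y \<bullet> (a *v y))"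
      by (intro continuous_intros linear_continuous_on linear_conv_bounded_linear[THEN iffD1]) simp
    then obtain x where x: "x \<in> ?K" and min: "\<forall>y\<in>?K. x \<bullet> (a *v x) \<le> y \<bullet> (a *v y)"
      using continuous_attains_inf[OF \<open>compact ?K\<close> False] by blast
    have "x \<bullet> (a *v x) \<noteq> 0"
    proof
      assume "x \<bullet> (a *v x) = 0"
      then have "a *v x = 0"
        by (rule psd_kernel[OF a])
      then have "x \<bullet> x = 0"
        using im_orthogonal_kernel[OF cta, of x] x by blast
      then show False
        using x by simp
    qed
    moreover have "0 \<le> x \<bullet> (a *v x)"
      using a by (simp add: psd_def)
    ultimately show ?thesis
      using min by (intro exI[of _ "x \<bullet> (a *v x)"]) simp
  qed
  then obtain \<mu> where \<mu>: "\<mu> > 0" "\<And>y. y \<in> ?K \<Longrightarrow> \<mu> \<le> y \<bullet> (a *v y)"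
    by blast
  have lower: "\<mu> * (norm y)\<^sup>2 \<le> y \<bullet> (a *v y)" if "y \<in> im a" for y
  proof (cases "y = 0")
    case False
    have "y /\<^sub>R norm y \<in> ?K"
      using that False by (simp add: subspace_scale subspace_im)
    from \<mu>(2)[OF this] show ?thesis
      using False by (simp add: power2_eq_square field_simps)
  qed simp
  obtain C where C: "C > 0" "\<And>y. norm (b *v y) \<le> norm y * C"
    using bounded_linear.pos_bounded[of "(*v) b"] linear_conv_bounded_linear[of "(*v) b"] by auto
  have upper: "y \<bullet> (b *v y) \<le> C * (norm y)\<^sup>2" for y
  proof -
    have "y \<bullet> (b *v y) \<le> norm y * norm (b *v y)"
      by (rule norm_cauchy_schwarz)
    also have "\<dots> \<le> norm y * (norm y * C)"
      by (intro mult_left_mono C) simp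
    finally show ?thesis
      by (simp add: power2_eq_square mult_ac)
  qed
  \<comment> \<open>The bound \<open>1 / 2\<close> ensures \<open>\<epsilon> < 1\<close>, so that
    the difference of two states can be divided by \<open>1 - \<epsilon>\<close> to give a state
    again.\<close>
  define \<epsilon> where "\<epsilon> = min (\<mu> / C) (1 / 2)"
  have \<epsilon>: "\<epsilon> > 0" "\<epsilon> < 1" "\<epsilon> * C \<le> \<mu>"
    using \<mu>(1) C(1) by (auto simp: \<epsilon>_def min_def field_simps)
  have "0 \<le> x \<bullet> ((a - \<epsilon> *\<^sub>R b) *v x)" for x
  proof -
    obtain y z where y: "y \<in> im a" and z: "\<And>w. w \<in> im a \<Longrightarrow> orthogonal z w" and xyz: "x = y + z"
      using orthogonal_subspace_decomp_exists[of "im a" x] span_eq_iff[THEN iffD2, OF subspace_im[of a]] by metis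
    have az: "a *v z = 0"
      using z im_orthogonal_kernel[OF cta, of z] by (auto simp: orthogonal_def)
    then have bz: "b *v z = 0"
      using im im_subset_iff_kernel[OF ctb cta] by blast
    have form: "x \<bullet> (c *v x) = y \<bullet> (c *v y)" if "ctranspose c = c" "c *v z = 0" for c
      using inner_matrix_vector[of z c y] that
      by (simp add: xyz matrix_vector_right_distrib inner_add_left)
    have "x \<bullet> ((a - \<epsilon> *\<^sub>R b) *v x) = y \<bullet> (a *v y) - \<epsilon> * (y \<bullet> (b *v y))"
      by (simp add: matrix_vector_mult_diff_rdistrib inner_diff_right form[OF cta az] form[OF ctb bz])
    moreover have "\<epsilon> * (y \<bullet> (b *v y)) \<le> \<epsilon> * (C * (norm y)\<^sup>2)"
      using upper \<epsilon> by (intro mult_left_mono) auto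
    moreover have "\<epsilon> * (C * (norm y)\<^sup>2) \<le> \<mu> * (norm y)\<^sup>2"
      using \<epsilon>(3) by (simp add: mult_right_mono mult.assoc[symmetric])
    ultimately show ?thesis
      using lower[OF y] by linarith
  qed
  then have "psd (a - \<epsilon> *\<^sub>R b)"
    by (simp add: psd_def cta ctb)
  with \<epsilon> show ?thesis
    by blast
qed

lemma psd_add:
  assumes "psd a" "psd b" "0 \<le> u" "0 \<le> v"
  shows "psd (u *\<^sub>R a + v *\<^sub>R b)"
  using assms by (simp add: psd_def matrix_vector_mult_add_rdistrib inner_add_right)

lemma convex_states:
  fixes A :: "(complex^'n^'n) set"
  assumes A: "cstar_subalgebra A"
  shows "convex (states A)"
proof (rule convexI)
  fix a b and u v :: real
  assume ab: "a \<in> states A" "b \<in> states A" and uv: "0 \<le> u" "0 \<le> v" "u + v = 1"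
  have "u *\<^sub>R a + v *\<^sub>R b \<in> A"
    using ab by (intro subspace_add subspace_scale subspace_cstar_subalgebra[OF A]) (auto simp: states_def)
  then show "u *\<^sub>R a + v *\<^sub>R b \<in> states A"
    using ab uv psd_add[of a b u v] by (simp add: mem_states_iff inner_add_left)
qed

lemma convex_mean_value_set:
  assumes "cstar_subalgebra A" "subspace U"
  shows "convex (mean_value_set A U)"
  unfolding mean_value_set_def
  by (rule convex_linear_image[OF linear_orth_proj[OF assms(2)] convex_states[OF assms(1)]])

text \<open>A vector annihilated by the mixture makes both non-negative forms zero and lies in both
  kernels; mixing therefore never shrinks a support.\<close>

lemma im_convex_combination:
  fixes a b :: "complex^'n^'n"
  assumes a: "psd a" and b: "psd b"
  shows "im a \<subseteq> im ((1/2) *\<^sub>R a + (1/2) *\<^sub>R b)" and "im b \<subseteq> im ((1/2) *\<^sub>R a + (1/2) *\<^sub>R b)"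
proof -
  let ?c = "(1/2) *\<^sub>R a + (1/2) *\<^sub>R b"
  have ct: "ctranspose a = a" "ctranspose b = b" "ctranspose ?c = ?c"
    using a b by (simp_all add: psd_def)
  have "a *v x = 0 \<and> b *v x = 0" if "?c *v x = 0" for x
  proof -
    have "x \<bullet> (?c *v x) = 0"
      using that by simp
    then have "x \<bullet> (a *v x) + x \<bullet> (b *v x) = 0"
      by (simp add: matrix_vector_mult_add_rdistrib inner_add_right)
    moreover have "0 \<le> x \<bullet> (a *v x)" "0 \<le> x \<bullet> (b *v x)"
      using a b by (simp_all add: psd_def)
    ultimately show ?thesis
      using psd_kernel[OF a, of x] psd_kernel[OF b, of x] by linarith
  qed
  then show "im a \<subseteq> im ?c" "im b \<subseteq> im ?c"
    using im_subset_iff_kernel[OF ct(1,3)] im_subset_iff_kernel[OF ct(2,3)] by blast+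
qed

text \<open>Take for \<open>p\<close> the support of a state of maximal rank with mean value in \<open>F\<close>.\<close>

lemma face_projection:
  fixes A :: "(complex^'n^'n) set"
  assumes A: "cstar_subalgebra A" and U: "subspace U"
    and F: "F face_of mean_value_set A U" and \<rho>: "\<rho> \<in> states A" "orth_proj U \<rho> \<in> F"
  shows "\<exists>p\<in>A. projection p \<and> p \<noteq> 0 \<and> states (compress p A) = {\<tau> \<in> states A. orth_proj U \<tau> \<in> F}"
proof -
  define G where "G = {\<tau> \<in> states A. orth_proj U \<tau> \<in> F}"
  note lin = linear_orth_proj[OF U]
  have "\<rho> \<in> G"
    using \<rho> by (simp add: G_def)
  moreover have "\<forall>\<tau>. \<tau> \<in> G \<longrightarrow> dim (im \<tau>) < Suc DIM(complex^'n)"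
    by (simp only: less_Suc_eq_le dim_subset_UNIV simp_thms)
  ultimately obtain \<tau>0 where \<tau>0: "\<tau>0 \<in> G" and max: "\<forall>\<tau>. \<tau> \<in> G \<longrightarrow> dim (im \<tau>) \<le> dim (im \<tau>0)"
    using ex_has_greatest_nat[of "\<lambda>\<tau>. \<tau> \<in> G" \<rho> "\<lambda>\<tau>. dim (im \<tau>)"] by blast
  have \<tau>0A: "\<tau>0 \<in> states A"
    using \<tau>0 by (simp add: G_def)
  then have psd0: "psd \<tau>0" and \<tau>0_A: "\<tau>0 \<in> A" and ct0: "ctranspose \<tau>0 = \<tau>0"
    by (auto simp: states_def psd_def)
  obtain p where p: "projection p" "im p = im \<tau>0"
    using support_projection by blast
  have pA: "p \<in> A"
    by (rule support_projection_in_algebra[OF A \<tau>0_A ct0 p])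
  have "p \<noteq> 0"
  proof
    assume "p = 0"
    then have "\<tau>0 *v x = 0" for x
      using p(2) by (auto simp: im_def)
    then have "\<tau>0 = 0"
      by (simp add: matrix_eq)
    then show False
      using \<tau>0A by (simp add: mem_states_iff)
  qed
  moreover have "states (compress p A) = G"
  proof (intro equalityI subsetI)
    fix \<tau> assume \<tau>: "\<tau> \<in> G"
    then have \<tau>A: "\<tau> \<in> states A"
      by (simp add: G_def)
    then have psd: "psd \<tau>"
      by (simp add: states_def)
    \<comment> \<open>The midpoint stays over \<open>F\<close> and its support contains that of
      \<open>\<tau>0\<close>. Maximal rank makes the two supports equal, so the support of
      \<open>\<tau>\<close> is contained in \<open>im p\<close>.\<close>
    let ?m = "(1/2) *\<^sub>R \<tau>0 + (1/2) *\<^sub>R \<tau>"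
    have "orth_proj U ?m = (1/2) *\<^sub>R orth_proj U \<tau>0 + (1/2) *\<^sub>R orth_proj U \<tau>"
      by (simp add: linear_add[OF lin] linear_scale[OF lin])
    also have "\<dots> \<in> F"
      using \<tau> \<tau>0 convexD[OF face_of_imp_convex[OF F], of "orth_proj U \<tau>0" "orth_proj U \<tau>" "1/2" "1/2"]
      by (simp add: G_def)
    finally have "?m \<in> G"
      using convexD[OF convex_states[OF A] \<tau>0A \<tau>A, of "1/2" "1/2"] by (simp add: G_def)
    then have "dim (im ?m) \<le> dim (im \<tau>0)"
      using max by blast
    then have "im \<tau>0 = im ?m"
      using im_convex_combination(1)[OF psd0 psd] by (intro subspace_dim_equal subspace_im)
    then have "im \<tau> \<subseteq> im p"
      using im_convex_combination(2)[OF psd0 psd] p(2) by simp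
    then show "\<tau> \<in> states (compress p A)"
      using im_state_subset_iff[OF A pA p(1) \<tau>A] by blast
  next
    fix \<tau> assume \<tau>: "\<tau> \<in> states (compress p A)"
    then have \<tau>A: "\<tau> \<in> states A"
      using mem_states_compress_iff[OF A pA p(1)] by blast
    then have psd: "psd \<tau>" and \<tau>_A: "\<tau> \<in> A"
      by (auto simp: states_def)
    have "im \<tau> \<subseteq> im \<tau>0"
      using \<tau> im_state_subset_iff[OF A pA p(1) \<tau>A] p(2) by blast
    then obtain \<epsilon> where \<epsilon>: "\<epsilon> > 0" "\<epsilon> < 1" and dom: "psd (\<tau>0 - \<epsilon> *\<^sub>R \<tau>)"
      using psd_dominates[OF psd0 psd] by blast
    \<comment> \<open>The remainder of \<open>\<tau>0\<close> after removing a small share of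
      \<open>\<tau>\<close>, normalised: \<open>\<tau>0\<close> becomes a proper mixture of
      \<open>\<kappa>\<close> and \<open>\<tau>\<close>, and the face property carries
      \<open>\<tau>\<close> into \<open>F\<close>.\<close>
    define \<kappa> where "\<kappa> = (1 / (1 - \<epsilon>)) *\<^sub>R (\<tau>0 - \<epsilon> *\<^sub>R \<tau>)"
    have "\<tau>0 - \<epsilon> *\<^sub>R \<tau> \<in> A"
      using \<tau>0_A \<tau>_A by (intro subspace_diff subspace_scale subspace_cstar_subalgebra[OF A])
    then have "\<kappa> \<in> A"
      unfolding \<kappa>_def by (intro subspace_scale subspace_cstar_subalgebra[OF A])
    moreover have "psd \<kappa>"
      using psd_add[OF dom dom, of "1 / (1 - \<epsilon>)" 0] \<epsilon> by (simp add: \<kappa>_def)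
    moreover have "\<kappa> \<bullet> mat 1 = 1"
      using \<tau>0A \<tau>A \<epsilon> by (simp add: \<kappa>_def mem_states_iff inner_diff_left)
    ultimately have \<kappa>: "\<kappa> \<in> states A"
      by (simp add: mem_states_iff)
    have "\<tau>0 = (1 - \<epsilon>) *\<^sub>R \<kappa> + \<epsilon> *\<^sub>R \<tau>"
      using \<epsilon> by (simp add: \<kappa>_def)
    then have eq: "orth_proj U \<tau>0 = (1 - \<epsilon>) *\<^sub>R orth_proj U \<kappa> + \<epsilon> *\<^sub>R orth_proj U \<tau>"
      by (simp only: linear_add[OF lin] linear_scale[OF lin])
    \<comment> \<open>Coinciding mean values need a case of their own, because the open segment is
      then empty.\<close>
    have "orth_proj U \<tau> \<in> F"
    proof (cases "orth_proj U \<kappa> = orth_proj U \<tau>")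
      case True
      then have "orth_proj U \<tau>0 = orth_proj U \<tau>"
        using eq by (simp add: algebra_simps)
      then show ?thesis
        using \<tau>0 by (simp add: G_def)
    next
      case False
      have M: "orth_proj U \<kappa> \<in> mean_value_set A U" "orth_proj U \<tau> \<in> mean_value_set A U"
        using \<kappa> \<tau>A by (auto simp: mean_value_set_def)
      have "orth_proj U \<tau>0 \<in> open_segment (orth_proj U \<kappa>) (orth_proj U \<tau>)"
        unfolding in_segment using False \<epsilon> eq by blast
      then show ?thesis
        using face_ofD[OF F _ M] \<tau>0 by (simp add: G_def)
    qed
    then show "\<tau> \<in> G"
      using \<tau>A by (simp add: G_def)
  qed
  ultimately show ?thesis
    using p(1) pA by (auto simp: G_def)
qed

text \<open>The last property expresses that the mean value of \<open>\<rho>\<close> is relatively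
  interior to its face: a functional from \<open>U\<close> that is maximal there is constant on the
  states over the face.\<close>

lemma supporting_lattice_projection:
  fixes A :: "(complex^'n^'n) set"
  assumes A: "cstar_subalgebra A" and U: "subspace U" "U \<subseteq> self_adjoint A" and \<rho>: "\<rho> \<in> states A"
  obtains p where "p \<in> proj_lattice A U" "p \<noteq> 0" "\<rho> \<in> states (compress p A)"
    "\<And>w \<tau>. w \<in> U \<Longrightarrow> \<forall>\<kappa>\<in>states (compress p A). \<kappa> \<bullet> w \<le> \<rho> \<bullet> w \<Longrightarrow>
      \<tau> \<in> states (compress p A) \<Longrightarrow> \<tau> \<bullet> w = \<rho> \<bullet> w"
proof -
  let ?M = "mean_value_set A U" and ?P = "orth_proj U"
  define F where "F = {y \<in> ?M. \<exists>\<epsilon>>0. ?P \<rho> + \<epsilon> *\<^sub>R (?P \<rho> - y) \<in> ?M}"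
  have F: "F face_of ?M"
    unfolding F_def by (rule face_of_extension[OF convex_mean_value_set[OF A U(1)]])
  have "?P \<rho> \<in> ?M"
    using \<rho> by (auto simp: mean_value_set_def)
  then have \<rho>F: "?P \<rho> \<in> F"
    by (auto simp: F_def intro: exI[of _ 1])
  obtain p where p: "p \<in> A" "projection p" "p \<noteq> 0"
    and G: "states (compress p A) = {\<tau> \<in> states A. ?P \<tau> \<in> F}"
    using face_projection[OF A U(1) F \<rho> \<rho>F] by blast
  have "p \<in> proj_lattice A U"
    using mem_proj_lattice_iff[OF A U] p F G by blast
  moreover have "\<rho> \<in> states (compress p A)"
    using G \<rho> \<rho>F by simp
  moreover have "\<tau> \<bullet> w = \<rho> \<bullet> w"
    if w: "w \<in> U" and le: "\<forall>\<kappa>\<in>states (compress p A). \<kappa> \<bullet> w \<le> \<rho> \<bullet> w" and \<tau>: "\<tau> \<in> states (compress p A)" for w \<tau>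
  proof -
    have "?P \<tau> \<in> F"
      using \<tau> G by simp
    then obtain \<epsilon> where \<epsilon>: "\<epsilon> > 0" and M: "?P \<rho> + \<epsilon> *\<^sub>R (?P \<rho> - ?P \<tau>) \<in> ?M" and \<tau>M: "?P \<tau> \<in> ?M"
      by (auto simp: F_def)
    then obtain \<kappa> where \<kappa>: "\<kappa> \<in> states A" "?P \<kappa> = ?P \<rho> + \<epsilon> *\<^sub>R (?P \<rho> - ?P \<tau>)"
      unfolding mean_value_set_def by (metis (no_types, lifting) imageE)
    \<comment> \<open>Prolonging from \<open>\<kappa>\<close> with factor
      \<open>1 / \<epsilon>\<close> leads back to the mean value of \<open>\<tau>\<close>, so
      \<open>\<kappa>\<close> lies over the same face. Since \<open>\<rho>\<close> has its mean
      value between the two, the upper bound at \<open>\<kappa>\<close> becomes a lower bound at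
      \<open>\<tau>\<close>.\<close>
    have "?P \<rho> + (1 / \<epsilon>) *\<^sub>R (?P \<rho> - ?P \<kappa>) = ?P \<tau>"
      using \<epsilon> by (simp add: \<kappa>(2))
    then have "?P \<kappa> \<in> F"
      using \<epsilon> M \<tau>M by (auto simp: F_def \<kappa>(2)[symmetric] intro!: exI[of _ "1 / \<epsilon>"])
    then have "\<kappa> \<in> states (compress p A)"
      using G \<kappa> by simp
    then have "\<kappa> \<bullet> w \<le> \<rho> \<bullet> w"
      using le by blast
    moreover have "\<kappa> \<bullet> w = \<rho> \<bullet> w + \<epsilon> * (\<rho> \<bullet> w - \<tau> \<bullet> w)"
      using inner_orth_proj[OF U(1) w, of \<kappa>]
      by (simp add: \<kappa>(2) inner_add_left inner_diff_left inner_orth_proj[OF U(1) w])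
    ultimately have "\<epsilon> * (\<rho> \<bullet> w - \<tau> \<bullet> w) \<le> 0"
      by simp
    then have "\<rho> \<bullet> w \<le> \<tau> \<bullet> w"
      using \<epsilon> by (simp add: mult_le_0_iff)
    then show ?thesis
      using le \<tau> by force
  qed
  ultimately show ?thesis
    using p(3) that by blast
qed

section \<open>Gibbs states with prescribed mean value\<close>

text \<open>Klein's inequality makes \<open>t \<mapsto> pexp p (c + t d) \<bullet> d\<close> non-negative for \<open>t > 0\<close> at a minimum \<open>c\<close>.\<close>

lemma trace_pexp_stationary:
  fixes c d p :: "complex^'n^'n"
  assumes p: "projection p" and c: "ctranspose c = c" "p ** c ** p = c"
    and d: "ctranspose d = d" "p ** d ** p = d"
    and min: "\<And>t. pexp p c \<bullet> mat 1 \<le> pexp p (c + t *\<^sub>R d) \<bullet> mat 1"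
  shows "0 \<le> pexp p c \<bullet> d"
proof -
  have pos: "0 \<le> pexp p (c + t *\<^sub>R d) \<bullet> d" if t: "t > 0" for t
  proof -
    have ct: "ctranspose (c + t *\<^sub>R d) = c + t *\<^sub>R d" "p ** (c + t *\<^sub>R d) ** p = c + t *\<^sub>R d"
      using c d by (simp_all add: matrix_add_ldistrib matrix_mult_add_rdistrib)
    have "pexp p (c + t *\<^sub>R d) \<bullet> (c - (c + t *\<^sub>R d)) \<le> pexp p c \<bullet> mat 1 - pexp p (c + t *\<^sub>R d) \<bullet> mat 1"
      by (rule klein_inequality[OF p c ct])
    also have "\<dots> \<le> 0"
      using min by simp
    finally show ?thesis
      using t by (simp add: zero_le_mult_iff)
  qed
  have "continuous_on UNIV (\<lambda>t. pexp p (c + t *\<^sub>R d) \<bullet> d)"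
    by (intro continuous_on_inner continuous_on_compose2[OF continuous_on_pexp] continuous_on_add
        continuous_on_scaleR continuous_on_const continuous_on_id subset_UNIV)
  then have "isCont (\<lambda>t. pexp p (c + t *\<^sub>R d) \<bullet> d) 0"
    by (simp add: continuous_on_eq_continuous_at)
  then have "((\<lambda>t. pexp p (c + t *\<^sub>R d) \<bullet> d) \<longlongrightarrow> pexp p (c + 0 *\<^sub>R d) \<bullet> d) (at_right 0)"
    by (simp add: isCont_def filterlim_at_split)
  then have "0 \<le> pexp p (c + 0 *\<^sub>R d) \<bullet> d"
    by (rule tendsto_lowerbound) (auto intro: pos eventually_at_right_less[THEN eventually_mono])
  then show ?thesis
    by simp
qed

text \<open>Otherwise normalised elements of the set accumulate at a unit direction \<open>l\<close>
  in \<open>L\<close>. Bounded traces bound the form of \<open>c n\<close> at the vector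
  \<open>x\<close> from \<open>dir\<close>, so after normalisation the limit satisfies
  \<open>x \<bullet> (l *v x) \<le> 0\<close>.\<close>

lemma trace_pexp_coercive:
  fixes a p :: "complex^'n^'n"
  assumes p: "projection p" and L: "subspace L"
    and comp: "\<And>c. c \<in> L \<Longrightarrow> ctranspose c = c \<and> p ** c ** p = c"
    and a: "ctranspose a = a" "p ** a ** p = a"
    and dir: "\<And>c. c \<in> L \<Longrightarrow> c \<noteq> 0 \<Longrightarrow> \<exists>x. p *v x = x \<and> norm x = 1 \<and> 0 < x \<bullet> (c *v x)"
  shows "bounded {c \<in> L. pexp p (a + c) \<bullet> mat 1 \<le> r}"
proof (rule ccontr)
  assume nb: "\<not> ?thesis"
  have "\<exists>c. c \<in> L \<and> pexp p (a + c) \<bullet> mat 1 \<le> r \<and> real n + 1 < norm c" for n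
    using nb unfolding bounded_iff by (force simp: not_le)
  then obtain c where cL: "\<And>n. c n \<in> L" and cr: "\<And>n. pexp p (a + c n) \<bullet> mat 1 \<le> r"
    and cn: "\<And>n. real n + 1 < norm (c n)"
    by metis
  have cn0: "norm (c n) > 0" for n
    using cn[of n] by linarith
  define s where "s n = c n /\<^sub>R norm (c n)" for n
  have "compact (sphere 0 1 \<inter> L)"
    using L by (simp add: closed_subspace compact_Int_closed)
  moreover have "s n \<in> sphere 0 1 \<inter> L" for n
    using cn0[of n] cL[of n] L by (simp add: s_def subspace_scale)
  ultimately obtain l q where l: "l \<in> sphere 0 1 \<inter> L" and q: "strict_mono q" and lim: "(s \<circ> q) \<longlonglongrightarrow> l"
    using compact_imp_seq_compact seq_compactE by metis
  have "l \<in> L" "l \<noteq> 0"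
    using l by auto
  from dir[OF this] obtain x where x: "p *v x = x" "norm x = 1" "0 < x \<bullet> (l *v x)"
    by blast
  \<comment> \<open>The bound comes from
    \<open>1 + x \<bullet> ((a + c n) *v x) \<le> 2 * r\<close>; the absolute value makes it
    non-negative, as replacing \<open>norm (c n)\<close> by the smaller \<open>real n + 1\<close>
    requires.\<close>
  define C where "C = \<bar>2 * r - 1 - x \<bullet> (a *v x)\<bar>"
  have le: "x \<bullet> (s n *v x) \<le> C / (real n + 1)" for n
  proof -
    have ac: "ctranspose (a + c n) = a + c n" "p ** (a + c n) ** p = a + c n"
      using a comp[OF cL[of n]] by (simp_all add: matrix_add_ldistrib matrix_mult_add_rdistrib)
    have "1 + x \<bullet> ((a + c n) *v x) \<le> 2 * (pexp p (a + c n) \<bullet> mat 1)"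
      using pexp_quadratic_form_ge[OF p ac x(1,2)] psd_quadratic_form_le_trace[OF psd_pexp[OF p ac] x(2)]
      by linarith
    then have "x \<bullet> (c n *v x) \<le> C"
      using cr[of n] by (simp add: C_def matrix_vector_mult_add_rdistrib inner_add_right)
    then have "x \<bullet> (s n *v x) \<le> C / norm (c n)"
      using cn0[of n] by (simp add: s_def divide_inverse mult.commute)
    also have "\<dots> \<le> C / (real n + 1)"
      using cn[of n] by (intro divide_left_mono) (auto simp: C_def intro!: mult_pos_pos)
    finally show ?thesis .
  qed
  have "bounded_linear (\<lambda>b :: complex^'n^'n. x \<bullet> (b *v x))"
    by (intro linear_conv_bounded_linear[THEN iffD1] linearI)
       (simp_all add: matrix_vector_mult_add_rdistrib inner_add_right)
  from bounded_linear.tendsto[OF this lim] have 1: "(\<lambda>n. x \<bullet> (s (q n) *v x)) \<longlonglongrightarrow> x \<bullet> (l *v x)"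
    by (simp add: o_def)
  have "(\<lambda>n. C / (real n + 1)) \<longlonglongrightarrow> 0"
    using tendsto_mult[OF tendsto_const[of C] LIMSEQ_inverse_real_of_nat]
    by (simp add: divide_inverse add.commute)
  then have 2: "(\<lambda>n. C / (real (q n) + 1)) \<longlonglongrightarrow> 0"
    using LIMSEQ_subseq_LIMSEQ[OF _ q] by (force simp: o_def)
  have "x \<bullet> (l *v x) \<le> 0"
    by (rule LIMSEQ_le[OF 1 2]) (use le in blast)
  with x show False
    by simp
qed

text \<open>Coercivity makes the sublevel set through 0 compact, so a minimum exists. One-sided
  stationarity along both \<open>d\<close> and \<open>- d\<close> gives the equality.\<close>

lemma trace_pexp_minimum:
  fixes a p :: "complex^'n^'n"
  assumes p: "projection p" and L: "subspace L"
    and comp: "\<And>c. c \<in> L \<Longrightarrow> ctranspose c = c \<and> p ** c ** p = c"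
    and a: "ctranspose a = a" "p ** a ** p = a"
    and dir: "\<And>c. c \<in> L \<Longrightarrow> c \<noteq> 0 \<Longrightarrow> \<exists>x. p *v x = x \<and> norm x = 1 \<and> 0 < x \<bullet> (c *v x)"
  shows "\<exists>c\<in>L. \<forall>d\<in>L. pexp p (a + c) \<bullet> d = 0"
proof -
  let ?g = "\<lambda>c. pexp p (a + c) \<bullet> mat 1"
  let ?K = "{c \<in> L. ?g c \<le> ?g 0}"
  have cont: "continuous_on S ?g" for S
    by (intro continuous_on_inner continuous_on_compose2[OF continuous_on_pexp] continuous_on_add
        continuous_on_const continuous_on_id subset_UNIV)
  have "closed ({c. ?g c \<le> ?g 0} \<inter> L)"
    by (intro closed_Int closed_Collect_le closed_subspace L cont continuous_on_const)
  then have "closed ?K"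
    by (simp add: Int_def conj_commute)
  then have "compact ?K"
    using trace_pexp_coercive[OF p L comp a dir] by (simp add: compact_eq_bounded_closed)
  moreover have "0 \<in> ?K"
    using L by (simp add: subspace_0)
  ultimately obtain c where c: "c \<in> ?K" and minK: "\<forall>d\<in>?K. ?g c \<le> ?g d"
    using continuous_attains_inf[OF _ _ cont, of ?K] by blast
  have min: "?g c \<le> ?g d" if "d \<in> L" for d
  proof (cases "d \<in> ?K")
    case True
    with minK show ?thesis
      by blast
  next
    case False
    with c that show ?thesis
      by simp
  qed
  have cL: "c \<in> L"
    using c by simp
  have ac: "ctranspose (a + c) = a + c" "p ** (a + c) ** p = a + c"
    using a comp[OF cL] by (simp_all add: matrix_add_ldistrib matrix_mult_add_rdistrib)
  have nonneg: "0 \<le> pexp p (a + c) \<bullet> d" if d: "d \<in> L" for d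
  proof (rule trace_pexp_stationary[OF p ac])
    show "ctranspose d = d" "p ** d ** p = d"
      using comp[OF d] by auto
    show "?g c \<le> pexp p (a + c + t *\<^sub>R d) \<bullet> mat 1" for t
      using min[of "c + t *\<^sub>R d"] L cL d by (simp add: subspace_add subspace_scale add.assoc)
  qed
  have "pexp p (a + c) \<bullet> d = 0" if "d \<in> L" for d
    using nonneg[OF that] nonneg[of "- d"] subspace_neg[OF L that] by simp
  with cL show ?thesis
    by blast
qed

lemma psd_uminus_compression:
  fixes c p :: "complex^'n^'n"
  assumes p: "projection p" and c: "ctranspose c = c" "p ** c ** p = c"
    and nonpos: "\<And>x. p *v x = x \<Longrightarrow> norm x = 1 \<Longrightarrow> x \<bullet> (c *v x) \<le> 0"
  shows "psd (- c)"
proof -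
  have "x \<bullet> (c *v x) \<le> 0" for x
  proof -
    have "c *v x = p *v (c *v (p *v x))"
      using c(2) by (simp add: matrix_vector_mul_assoc matrix_mul_assoc)
    then have eq: "x \<bullet> (c *v x) = (p *v x) \<bullet> (c *v (p *v x))"
      using p inner_matrix_vector[of x p "c *v (p *v x)"] by (simp add: projection_def)
    show ?thesis
    proof (cases "p *v x = 0")
      case True
      then show ?thesis
        by (simp add: eq)
    next
      case False
      let ?y = "(p *v x) /\<^sub>R norm (p *v x)"
      have "p *v ?y = ?y"
        using p by (simp add: matrix_vector_mul_assoc projection_def)
      moreover have "norm ?y = 1"
        using False by simp
      ultimately have "?y \<bullet> (c *v ?y) \<le> 0"
        by (rule nonpos)
      then show ?thesis
        using False by (simp add: eq mult_le_0_iff zero_less_mult_iff)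
    qed
  qed
  then show ?thesis
    using c(1) by (simp add: psd_def)
qed

lemma gibbs_with_mean_value:
  fixes A :: "(complex^'n^'n) set"
  assumes A: "cstar_subalgebra A" and U: "subspace U" "U \<subseteq> self_adjoint A"
    and p: "p \<in> A" "projection p" "p \<noteq> 0" and \<rho>: "\<rho> \<in> states (compress p A)"
    and rec: "\<And>w \<tau>. w \<in> U \<Longrightarrow> \<forall>\<kappa>\<in>states (compress p A). \<kappa> \<bullet> w \<le> \<rho> \<bullet> w \<Longrightarrow>
      \<tau> \<in> states (compress p A) \<Longrightarrow> \<tau> \<bullet> w = \<rho> \<bullet> w"
    and \<theta>: "\<theta> \<in> self_adjoint A"
  shows "\<exists>u\<in>U. orth_proj U (gibbs (compress p A) (p ** (\<theta> + u) ** p)) = orth_proj U \<rho>"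
proof -
  \<comment> \<open>Centring at \<open>\<rho>\<close>: a state \<open>\<tau>\<close> of
    \<open>p A p\<close> pairs with \<open>b u\<close> to
    \<open>\<tau> \<bullet> u - \<rho> \<bullet> u\<close>, so orthogonality to all
    \<open>b u\<close> says that the mean values agree.\<close>
  define b where "b u = p ** u ** p - (\<rho> \<bullet> u) *\<^sub>R p" for u
  have ctp: "ctranspose p = p" and pp: "p ** p = p"
    using p by (auto simp: projection_def)
  have pS: "subspace A"
    by (rule subspace_cstar_subalgebra[OF A])
  have lin: "linear b"
    by (rule linearI) (simp_all add: b_def matrix_add_ldistrib matrix_mult_add_rdistrib inner_add_right algebra_simps)
  have b: "b u \<in> A" "ctranspose (b u) = b u" "p ** b u ** p = b u" if "u \<in> self_adjoint A" for u
  proof -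
    have u: "u \<in> A" "ctranspose u = u"
      using that by (auto simp: self_adjoint_def)
    show "b u \<in> A"
      unfolding b_def using u p by (intro subspace_diff[OF pS] subspace_scale[OF pS] cstar_subalgebra_mult[OF A])
    show "ctranspose (b u) = b u"
      by (simp add: b_def ctranspose_compression[OF p(2) u(2)] ctp)
    show "p ** b u ** p = b u"
      by (simp add: b_def matrix_mult_diff compression_idem[OF p(2)] pp)
  qed
  have inner_b: "\<tau> \<bullet> b u = \<tau> \<bullet> u - \<rho> \<bullet> u" if "\<tau> \<in> states (compress p A)" for \<tau> u
    using state_inner_compression[OF A p(1,2) that] state_inner_projection[OF A p(1,2) that]
    by (simp add: b_def inner_diff_right)
  have L: "subspace (b ` U)"
    by (rule linear_subspace_image[OF lin U(1)])
  have comp: "ctranspose c = c \<and> p ** c ** p = c" if "c \<in> b ` U" for c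
    using that b U(2) by blast
  have dir: "\<exists>x. p *v x = x \<and> norm x = 1 \<and> 0 < x \<bullet> (c *v x)" if c: "c \<in> b ` U" "c \<noteq> 0" for c
  proof (rule ccontr)
    assume no: "\<not> ?thesis"
    obtain u where u: "u \<in> U" "c = b u"
      using c by blast
    have cA: "c \<in> A"
      using b(1) u U(2) by blast
    have psd: "psd (- c)"
      by (rule psd_uminus_compression[OF p(2)]) (use comp[OF c(1)] no not_less in blast)+
    have "\<kappa> \<bullet> c \<le> 0" if "\<kappa> \<in> states (compress p A)" for \<kappa>
      using psd_inner_nonneg[OF _ psd, of \<kappa>] that by (simp add: states_def)
    then have "\<forall>\<kappa>\<in>states (compress p A). \<kappa> \<bullet> u \<le> \<rho> \<bullet> u"
      using inner_b u(2) by fastforce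
    then have zero: "\<tau> \<bullet> c = 0" if "\<tau> \<in> states (compress p A)" for \<tau>
      using rec[OF u(1) _ that] inner_b[OF that] u(2) by simp
    define t where "t = (- c) \<bullet> mat 1"
    have "0 \<le> t"
      unfolding t_def by (rule psd_inner_nonneg[OF psd psd_mat_1])
    moreover have "t \<noteq> 0"
      using psd_trace_zero[OF psd] c(2) by (auto simp: t_def)
    ultimately have t: "0 < t"
      by simp
    \<comment> \<open>This state would have to be orthogonal to \<open>c\<close> by
      \<open>zero\<close>, but it is a non-zero multiple of \<open>c\<close>.\<close>
    let ?\<tau> = "(1 / t) *\<^sub>R (- c)"
    have "?\<tau> \<in> A"
      using cA by (intro subspace_scale[OF pS] subspace_neg[OF pS])
    moreover have "psd ?\<tau>"
      using psd_add[OF psd psd, of "1 / t" 0] t by simp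
    moreover have "?\<tau> \<bullet> mat 1 = 1"
      using t by (simp add: t_def)
    moreover have "p ** ?\<tau> ** p = ?\<tau>"
      using comp[OF c(1)] by (simp only: matrix_mult_scaleR matrix_uminus)
    ultimately have "?\<tau> \<in> states (compress p A)"
      by (simp only: mem_states_compress_iff[OF A p(1,2)] mem_states_iff[of _ A] simp_thms)
    from zero[OF this] show False
      using t c(2) by simp
  qed
  obtain u where u: "u \<in> U" and stat: "\<And>w. w \<in> U \<Longrightarrow> pexp p (b \<theta> + b u) \<bullet> b w = 0"
    using trace_pexp_minimum[OF p(2) L comp b(2,3)[OF \<theta>] dir] by blast
  define h where "h = p ** (\<theta> + u) ** p"
  have \<theta>u: "\<theta> + u \<in> self_adjoint A"
    using \<theta> u U(2) subspace_add[OF pS] by (auto simp: self_adjoint_def)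
  interpret gibbs_data A p h
    unfolding h_def by (rule gibbs_data_compression[OF A p \<theta>u])
  \<comment> \<open>The centred exponent differs from \<open>h\<close> by a multiple of
    \<open>p\<close>, so its exponential is a positive multiple of the Gibbs state and stationarity
    passes to the latter.\<close>
  have "b \<theta> + b u = h + (- (\<rho> \<bullet> (\<theta> + u))) *\<^sub>R p"
    using linear_add[OF lin, of \<theta> u] by (simp add: b_def h_def)
  then have "pexp p (b \<theta> + b u) = exp (- (\<rho> \<bullet> (\<theta> + u))) *\<^sub>R pexp p h"
    by (simp only: pexp_shift[OF p h php])
  then have "pexp p h \<bullet> b w = 0" if "w \<in> U" for w
    using stat[OF that] by simp
  then have "gibbs (compress p A) h \<bullet> b w = 0" if "w \<in> U" for w
    using that by (simp add: gibbs_eq)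
  then have "gibbs (compress p A) h \<bullet> w = \<rho> \<bullet> w" if "w \<in> U" for w
    using that inner_b[OF gibbs_state] by simp
  then have "orth_proj U (gibbs (compress p A) h) = orth_proj U \<rho>"
    by (simp add: orth_proj_eq_iff[OF U(1)])
  with u show ?thesis
    unfolding h_def by blast
qed

lemma translation_space_affine:
  assumes \<Theta>: "affine \<Theta>" "\<theta> \<in> \<Theta>"
  shows "subspace (translation_space \<Theta>)" and "u \<in> translation_space \<Theta> \<Longrightarrow> \<theta> + u \<in> \<Theta>"
proof -
  have mem: "\<theta> + (s - t) \<in> \<Theta>" if "s \<in> \<Theta>" "t \<in> \<Theta>" for s t
    using mem_affine_3_minus[OF \<Theta> that, of 1] by simp
  then show "u \<in> translation_space \<Theta> \<Longrightarrow> \<theta> + u \<in> \<Theta>"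
    by (auto simp: translation_space_def)
  have "translation_space \<Theta> = (\<lambda>x. - \<theta> + x) ` \<Theta>"
  proof
    show "translation_space \<Theta> \<subseteq> (\<lambda>x. - \<theta> + x) ` \<Theta>"
    proof
      fix u assume "u \<in> translation_space \<Theta>"
      then have "\<theta> + u \<in> \<Theta>"
        using mem by (auto simp: translation_space_def)
      then show "u \<in> (\<lambda>x. - \<theta> + x) ` \<Theta>"
        by (intro image_eqI[of _ _ "\<theta> + u"]) auto
    qed
    show "(\<lambda>x. - \<theta> + x) ` \<Theta> \<subseteq> translation_space \<Theta>"
      using \<Theta>(2) by (auto simp: translation_space_def)
  qed
  then show "subspace (translation_space \<Theta>)"
    using affine_diffs_subspace[OF \<Theta>] by simp
qed

theorem theorem6p12:
  fixes A \<Theta> :: "(complex^'n^'n) set" and \<rho> \<sigma> :: "complex^'n^'n"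
  assumes "cstar_subalgebra A"
    and "\<Theta> \<subseteq> self_adjoint A" and "affine \<Theta>" and "\<Theta> \<noteq> {}"
    and "\<rho> \<in> states A"
    and "\<sigma> \<in> ext_family A \<Theta>"
  shows "rel_entropy \<rho> (proj_family A \<Theta> \<rho>) + rel_entropy (proj_family A \<Theta> \<rho>) \<sigma> =
    rel_entropy \<rho> \<sigma>"
proof -
  note A = assms(1) and \<rho> = assms(5)
  define U where "U = translation_space \<Theta>"
  obtain \<theta> where \<theta>: "\<theta> \<in> \<Theta>"
    using assms(4) by blast
  have \<Theta>: "s \<in> self_adjoint A" if "s \<in> \<Theta>" for s
    using that assms(2) by blast
  have U: "subspace U"
    unfolding U_def by (rule translation_space_affine(1)[OF assms(3) \<theta>])
  have diff: "s - t \<in> U" if "s \<in> \<Theta>" "t \<in> \<Theta>" for s t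
    using that by (auto simp: U_def translation_space_def)
  have UA: "U \<subseteq> self_adjoint A"
  proof
    fix u assume "u \<in> U"
    then obtain s t where "s \<in> \<Theta>" "t \<in> \<Theta>" "u = s - t"
      by (auto simp: U_def translation_space_def)
    then show "u \<in> self_adjoint A"
      using \<Theta> subspace_diff[OF subspace_cstar_subalgebra[OF A]] by (simp add: self_adjoint_def)
  qed
  have ext: "\<tau> \<in> ext_family A \<Theta> \<longleftrightarrow>
      (\<exists>p s. p \<in> proj_lattice A U \<and> p \<noteq> 0 \<and> s \<in> \<Theta> \<and> \<tau> = gibbs (compress p A) (p ** s ** p))" for \<tau>
    unfolding ext_family_def exp_family_def compress_def[of _ \<Theta>] U_def by blast
  obtain q where q: "q \<in> proj_lattice A U" "q \<noteq> 0" "\<rho> \<in> states (compress q A)"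
    and rec: "\<And>w \<tau>. w \<in> U \<Longrightarrow> \<forall>\<kappa>\<in>states (compress q A). \<kappa> \<bullet> w \<le> \<rho> \<bullet> w \<Longrightarrow>
      \<tau> \<in> states (compress q A) \<Longrightarrow> \<tau> \<bullet> w = \<rho> \<bullet> w"
    using supporting_lattice_projection[OF A U UA \<rho>] by metis
  have "q \<in> A" "projection q"
    using q by (auto simp: proj_lattice_def)
  from gibbs_with_mean_value[OF A U UA this q(2,3) rec \<Theta>[OF \<theta>]]
  obtain u where u: "u \<in> U"
    and eq: "orth_proj U (gibbs (compress q A) (q ** (\<theta> + u) ** q)) = orth_proj U \<rho>"
    by blast
  define t \<tau> where "t = \<theta> + u" and "\<tau> = gibbs (compress q A) (q ** t ** q)"
  have t: "t \<in> \<Theta>"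
    using translation_space_affine(2)[OF assms(3) \<theta>] u by (simp add: t_def U_def)
  have \<tau>: "orth_proj U \<tau> = orth_proj U \<rho>"
    using eq by (simp add: \<tau>_def t_def)
  \<comment> \<open>\<open>proj_family\<close> is a definite description: the constructed
    \<open>\<tau>\<close> provides existence, injectivity of the mean value on the extension
    provides uniqueness.\<close>
  have "proj_family A \<Theta> \<rho> = \<tau>"
    unfolding proj_family_def U_def[symmetric]
  proof (rule the_equality)
    show "\<tau> \<in> ext_family A \<Theta> \<and> orth_proj U \<tau> = orth_proj U \<rho>"
      using q t \<tau> unfolding ext by (auto simp: \<tau>_def)
  next
    fix \<kappa> assume \<kappa>: "\<kappa> \<in> ext_family A \<Theta> \<and> orth_proj U \<kappa> = orth_proj U \<rho>"
    then obtain p s where p: "p \<in> proj_lattice A U" "p \<noteq> 0" and s: "s \<in> \<Theta>"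
      and \<kappa>_eq: "\<kappa> = gibbs (compress p A) (p ** s ** p)"
      unfolding ext by blast
    show "\<kappa> = \<tau>"
      unfolding \<kappa>_eq \<tau>_def
      by (rule gibbs_mean_value_inj[OF A U UA p q(1,2) \<Theta>[OF s] \<Theta>[OF t] diff[OF s t]])
         (use \<kappa> \<tau> in \<open>simp add: \<kappa>_eq \<tau>_def\<close>)
  qed
  moreover obtain p s where p: "p \<in> proj_lattice A U" "p \<noteq> 0" and s: "s \<in> \<Theta>"
    and \<sigma>: "\<sigma> = gibbs (compress p A) (p ** s ** p)"
    using assms(6) unfolding ext by blast
  ultimately show ?thesis
    using pythagoras[OF A U UA p q(1,2) \<Theta>[OF s] \<Theta>[OF t] diff[OF s t] \<rho> \<sigma> \<tau>_def \<tau>] by simp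
qed

end
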